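(* Let $n\ge 3$ and $m\ge 4$ be integers. For integers $0\le l\le n$ put $\alpha_l = 2\left(1-\cos\frac{l\pi}{n}\right)$, and put $\beta^{-}_{m,1}=\frac12\left[m+1-\sqrt{(m+1)^2-4}\right]$. Assume $\beta^{-}_{m,1}\notin\{\alpha_l : 0\le l\le n\}$. Let $\delta_0>0$ be an arbitrary real number, let $L_G$ be the Laplacian of the unmodified graph of Model I, and let $L_{G_p}=L_G(\delta_0)$ be the Laplacian of the modified graph of Model I (both written out explicitly in the context). Then all the eigenvalues of $L_{G_p}$ are real. Moreover: (i) if $\alpha_1<\beta^{-}_{m,1}$, then $\lambda_2(L_{G_p})<\lambda_2(L_G)$; (ii) if $\beta^{-}_{m,1}<\alpha_1$, then $\lambda_2(L_{G_p})>\lambda_2(L_G)$.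
   Context: Laplacian convention: for a weighted digraph with adjacency matrix $A=(A_{ij})$, $A_{ij}\ge 0$ being the weight of the edge from node $j$ to node $i$, the Laplacian is $L=D-A$, where $D$ is diagonal with $D_{ii}=\sum_j A_{ij}$. Model I: the unmodified graph $G$ consists of an undirected cycle $C_n$ with nodes $0,\dots,n-1$, an undirected star $S_m$ with $m$ nodes $0,\dots,m-1$ (node $0$ is the hub, the others are leaves), all these edges having weight $1$, and one directed edge of weight $1$ from node $0$ of the cycle to the hub of the star. The modified graph $G_p$ is obtained by adding a directed edge of weight $\delta_0$ from the hub of the star to node $0$ of the cycle. Explicitly, ordering the cycle nodes first and then the star nodes, these are the $(n+m)\times(n+m)$ real matrices $$L_G=\begin{pmatrix} L_{C_n} & 0\\ -C & L_{S_m}+D_C\end{pmatrix},\qquad L_{G_p}=\begin{pmatrix} L_{C_n}+D_\Delta & -\Delta\\ -C & L_{S_m}+D_C\end{pmatrix},$$ where $L_{C_n}$ is the Laplacian of the cycle ($2$ on the diagonal, $-1$ at cyclically adjacent pairs), $L_{S_m}=\begin{pmatrix} m-1 & -\mathbf 1_{m-1}^{\top}\\ -\mathbf 1_{m-1} & I_{m-1}\end{pmatrix}$ (with $\mathbf 1_{k}$ the all-ones vector in $\mathbb R^k$), $C$ is the $m\times n$ matrix whose only nonzero entry is its top-left entry, equal to $1$, $D_C$ is the $m\times m$ matrix whose only nonzero entry is its top-left entry, equal to $1$, $\Delta$ is the $n\times m$ matrix whose only nonzero entry is its top-left entry, equal to $\delta_0$, and $D_\Delta$ is the $n\times n$ matrix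 whose only nonzero entry is its top-left entry, equal to $\delta_0$. Spectral gap: for each of these Laplacians $0$ is a simple eigenvalue and all other eigenvalues have positive real part. Listing the eigenvalues with algebraic multiplicity as $0=\lambda_1<\mathrm{Re}(\lambda_2)\le \mathrm{Re}(\lambda_3)\le\cdots$, $\lambda_2(L)$ denotes the second one in this ordering by real parts. *)

theory Defs
  imports Complex_Main "Jordan_Normal_Form.Char_Poly"
begin

definition laplacian :: "real mat \<Rightarrow> real mat" where
  "laplacian A = mat (dim_row A) (dim_row A)
     (\<lambda>(i, j). (if i = j then \<Sum>k<dim_row A. A $$ (i, k) else 0) - A $$ (i, j))"

definition cycle_adj :: "nat \<Rightarrow> real mat" where
  "cycle_adj n = mat n n (\<lambda>(i, j). if j = (i + 1) mod n \<or> i = (j + 1) mod n then 1 else 0)"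

definition star_adj :: "nat \<Rightarrow> real mat" where
  "star_adj m = mat m m (\<lambda>(i, j). if (i = 0) \<noteq> (j = 0) then 1 else 0)"

definition corner :: "nat \<Rightarrow> nat \<Rightarrow> real \<Rightarrow> real mat" where
  "corner r c x = mat r c (\<lambda>(i, j). if i = 0 \<and> j = 0 then x else 0)"

definition L_cycle :: "nat \<Rightarrow> real mat" where
  "L_cycle n = mat n n (\<lambda>(i, j).
     if i = j then 2 else if j = (i + 1) mod n \<or> i = (j + 1) mod n then - 1 else 0)"

definition L_star :: "nat \<Rightarrow> real mat" where
  "L_star m = mat m m (\<lambda>(i, j).
     if i = j then (if i = 0 then real m - 1 else 1) else if i = 0 \<or> j = 0 then - 1 else 0)"

definition L_G :: "nat \<Rightarrow> nat \<Rightarrow> real mat" where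
  "L_G n m = four_block_mat
     (L_cycle n)         (0\<^sub>m n m)
     (- corner m n 1)    (L_star m + corner m m 1)"

definition L_Gp :: "nat \<Rightarrow> nat \<Rightarrow> real \<Rightarrow> real mat" where
  "L_Gp n m \<delta> = four_block_mat
     (L_cycle n + corner n n \<delta>)    (- corner n m \<delta>)
     (- corner m n 1)              (L_star m + corner m m 1)"

text \<open>In the convention that entry \<open>(i, j)\<close> of an adjacency matrix is the weight of
  the edge from \<open>j\<close> to \<open>i\<close>, the block matrices above are the Laplacians of the two digraphs
  (lemmas \<open>L_Gp_0\<close> and \<open>laplacian_adj_Gp\<close>).\<close>

definition adj_Gp :: "nat \<Rightarrow> nat \<Rightarrow> real \<Rightarrow> real mat" where
  "adj_Gp n m \<delta> = four_block_mat (cycle_adj n) (corner n m \<delta>) (corner m n 1) (star_adj m)"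

lemma L_Gp_0: "L_Gp n m 0 = L_G n m"
  unfolding L_Gp_def L_G_def
  by (rule arg_cong2[where f = "\<lambda>A B. four_block_mat A B (- corner m n 1) (L_star m + corner m m 1)"])
    (auto simp: corner_def L_cycle_def intro!: eq_matI)

lemma cycle_row_sum:
  assumes n: "n \<ge> 3" and i: "i < n"
  shows "(\<Sum>k<n. cycle_adj n $$ (i, k)) = 2"
proof -
  have s: "k < n \<Longrightarrow> (i = (k + 1) mod n) = (k = (i + n - 1) mod n)" for k
    using n i by (cases "k + 1 = n"; cases "i = 0") (auto simp: mod_if)
  have ne: "(i + 1) mod n \<noteq> (i + n - 1) mod n"
    using n i by (auto simp: mod_if)
  have "(\<Sum>k<n. cycle_adj n $$ (i, k))
      = (\<Sum>k<n. if k \<in> {(i + 1) mod n, (i + n - 1) mod n} then 1 else 0)"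
    using i s by (intro sum.cong) (auto simp: cycle_adj_def)
  also have "\<dots> = (\<Sum>k\<in>{(i + 1) mod n, (i + n - 1) mod n}. 1)"
    using n by (subst sum.inter_restrict[symmetric]) (auto intro!: sum.cong)
  finally show ?thesis using ne by simp
qed

lemma star_row_sum:
  assumes "i < m"
  shows "(\<Sum>k<m. star_adj m $$ (i, k)) = (if i = 0 then real m - 1 else 1)"
proof -
  have "(\<Sum>k<m. star_adj m $$ (i, k)) = (\<Sum>k<m. if (i = 0) \<noteq> (k = 0) then 1 else 0)"
    using assms by (intro sum.cong) (auto simp: star_adj_def)
  also have "\<dots> = real (card {k \<in> {..<m}. (i = 0) \<noteq> (k = 0)})"
    by (simp add: sum.If_cases Int_def)
  also have "{k \<in> {..<m}. (i = 0) \<noteq> (k = 0)} = (if i = 0 then {1..<m} else {0})"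
    using assms by auto
  finally show ?thesis using assms by (auto simp: of_nat_diff)
qed

lemma laplacian_adj_Gp:
  assumes n: "n \<ge> 3" and m: "m > 0"
  shows "L_Gp n m \<delta> = laplacian (adj_Gp n m \<delta>)"
proof (rule eq_matI)
  have d: "dim_row (adj_Gp n m \<delta>) = n + m"
    by (simp add: adj_Gp_def cycle_adj_def star_adj_def)
  fix i j assume "i < dim_row (laplacian (adj_Gp n m \<delta>))" "j < dim_col (laplacian (adj_Gp n m \<delta>))"
  then have ij: "i < n + m" "j < n + m" by (simp_all add: laplacian_def d)
  have split: "(\<Sum>k<n + m. f k) = (\<Sum>k<n. f k) + (\<Sum>k<m. f (n + k))" for f :: "nat \<Rightarrow> real"
    by (induction m) (simp_all add: add.assoc)
  have rs: "(\<Sum>k<n + m. adj_Gp n m \<delta> $$ (i, k)) =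
     (if i < n then 2 + (if i = 0 then \<delta> else 0)
      else (if i = n then real m else 1))"
  proof (cases "i < n")
    case True
    have "(\<Sum>k<n + m. adj_Gp n m \<delta> $$ (i, k)) =
       (\<Sum>k<n. cycle_adj n $$ (i, k)) + (\<Sum>k<m. if k = 0 then (if i = 0 then \<delta> else 0) else 0)"
      unfolding split using True
      by (intro arg_cong2[where f = "(+)"] sum.cong)
        (auto simp: adj_Gp_def corner_def cycle_adj_def star_adj_def)
    then show ?thesis using cycle_row_sum[OF n True] True m by (simp add: sum.delta)
  next
    case False
    have "(\<Sum>k<n + m. adj_Gp n m \<delta> $$ (i, k)) =
       (\<Sum>k<n. if k = 0 then (if i = n then 1 else 0) else 0) + (\<Sum>k<m. star_adj m $$ (i - n, k))"
      unfolding split using False ij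
      by (intro arg_cong2[where f = "(+)"] sum.cong)
        (auto simp: adj_Gp_def corner_def cycle_adj_def star_adj_def)
    then show ?thesis using star_row_sum[of "i - n" m] False ij n by (simp add: sum.delta)
  qed
  have L: "laplacian (adj_Gp n m \<delta>) $$ (i, j) =
    (if i = j then \<Sum>k<n + m. adj_Gp n m \<delta> $$ (i, k) else 0) - adj_Gp n m \<delta> $$ (i, j)"
    using ij by (simp add: laplacian_def d)
  have noloop: "k < n \<Longrightarrow> Suc k mod n \<noteq> k" for k using n by (auto simp: mod_if)
  show "L_Gp n m \<delta> $$ (i, j) = laplacian (adj_Gp n m \<delta>) $$ (i, j)"
    unfolding L rs
  proof (cases "i < n"; cases "j < n")
    assume "i < n" "j < n"
    then show "L_Gp n m \<delta> $$ (i, j) = (if i = j then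
        if i < n then 2 + (if i = 0 then \<delta> else 0) else if i = n then real m else 1 else 0)
        - adj_Gp n m \<delta> $$ (i, j)"
      using noloop noloop[symmetric] ij n by (simp add: L_Gp_def L_cycle_def L_star_def corner_def adj_Gp_def
        cycle_adj_def star_adj_def, auto)
  qed (use ij in \<open>simp_all add: L_Gp_def L_cycle_def L_star_def corner_def adj_Gp_def
        cycle_adj_def star_adj_def, auto\<close>)
qed (simp_all add: laplacian_def L_Gp_def adj_Gp_def L_cycle_def L_star_def corner_def
       cycle_adj_def star_adj_def)

definition cmat :: "real mat \<Rightarrow> complex mat" where
  "cmat A = map_mat complex_of_real A"

text \<open>The real parts of all complex eigenvalues, with algebraic multiplicity, in increasing order;
  \<open>lambda2\<close> is the second of them (index 1; index 0 holds the simple eigenvalue 0 of the Laplacians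
  considered here), hence the eigenvalue itself whenever the spectrum is real.\<close>

definition sorted_spectrum :: "real mat \<Rightarrow> real list" where
  "sorted_spectrum A = sorted_list_of_multiset (image_mset Re (proots (char_poly (cmat A))))"

definition lambda2 :: "real mat \<Rightarrow> real" where
  "lambda2 A = sorted_spectrum A ! 1"

definition alpha :: "nat \<Rightarrow> nat \<Rightarrow> real" where
  "alpha n l = 2 * (1 - cos (real l * pi / real n))"

text \<open>The smaller root of \<open>x\<^sup>2 - (m + 1) x + 1\<close>.\<close>

definition beta_minus :: "nat \<Rightarrow> real" where
  "beta_minus m = (real m + 1 - sqrt ((real m + 1)\<^sup>2 - 4)) / 2"

end

theory Submission
  imports Defs
begin

text \<open>Weighting the cycle nodes by \<open>1\<close> and the star nodes by \<open>\<delta>0\<close> symmetrises the modified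
  Laplacian, so its spectrum is real and nonnegative. Conjugating the all-ones eigenvector into
  the first coordinate splits off a factor \<open>x\<close> of the characteristic polynomial, and what remains
  has exactly the nonzero eigenvalues as roots; so \<open>lambda2\<close> is the least nonzero eigenvalue.
  For \<open>L_G\<close> this is the minimum of \<open>alpha n 2\<close> and \<open>beta_minus m\<close>. For the modified graph, put
  \<open>\<lambda> = 2 - 2 cos \<theta>\<close> with \<open>0 < \<theta> < 2\<pi>/n\<close>: on the cycle, an eigenvector is proportional
  to \<open>cos ((n/2 - k) \<theta>)\<close>, and matching it with the star gives the scalar equation
  \<open>\<delta>0 \<lambda> (\<lambda> - m) cos (n \<theta>/2) = 2 (\<lambda>\<^sup>2 - (m + 1) \<lambda> + 1) sin \<theta> sin (n \<theta>/2)\<close>.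
  At \<open>\<theta> = \<pi>/n\<close>, i.e. \<open>\<lambda> = alpha n 1\<close>, the cosine vanishes. If \<open>alpha n 1 < beta_minus m\<close>, the
  difference of the two sides changes sign between \<open>alpha n 1\<close> and \<open>lambda2 (L_G n m)\<close>; if
  \<open>beta_minus m < alpha n 1\<close>, it is negative for all \<open>0 < \<lambda> \<le> beta_minus m\<close>.\<close>

subsection \<open>Laplacians with a simple eigenvalue 0\<close>

text \<open>\<open>P\<close> maps the first unit vector to the all-ones vector, which
  \<open>A\<close> kills. Hence \<open>T\<close>, the conjugate of \<open>A\<close> by
  \<open>P\<close>, has a zero first column, and deleting its row and column 0 leaves
  \<open>B\<close>.\<close>

lemma char_poly_zero_row_sums:
  fixes A :: "complex mat"
  assumes A: "A \<in> carrier_mat (Suc N) (Suc N)"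
    and rows: "\<And>i. i < Suc N \<Longrightarrow> (\<Sum>k<Suc N. A $$ (i, k)) = 0"
  defines "B \<equiv> mat N N (\<lambda>(i, j). A $$ (Suc i, Suc j) - A $$ (0, Suc j))"
  shows "char_poly A = [:0, 1:] * char_poly B"
proof -
  define T where "T = mat (Suc N) (Suc N)
    (\<lambda>(i, j). if j = 0 then 0 else if i = 0 then A $$ (0, j) else A $$ (i, j) - A $$ (0, j))"
  define P :: "complex mat" where
    "P = mat (Suc N) (Suc N) (\<lambda>(i, j). if i = j \<or> j = 0 then 1 else 0)"
  define Q :: "complex mat" where
    "Q = mat (Suc N) (Suc N) (\<lambda>(i, j). if i = j then 1 else if j = 0 then - 1 else 0)"
  have carr: "T \<in> carrier_mat (Suc N) (Suc N)" "P \<in> carrier_mat (Suc N) (Suc N)"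
    "Q \<in> carrier_mat (Suc N) (Suc N)"
    by (simp_all add: T_def P_def Q_def)
  have P_mult: "(P * M) $$ (i, j) = (if i = 0 then M $$ (0, j) else M $$ (0, j) + M $$ (i, j))"
    if "i < Suc N" "j < Suc N" and M: "M \<in> carrier_mat (Suc N) (Suc N)" for M i j
  proof -
    have "(P * M) $$ (i, j) = (\<Sum>k<Suc N. (if i = k \<or> k = 0 then 1 else 0) * M $$ (k, j))"
      using that by (simp add: P_def scalar_prod_def atLeast0LessThan)
    also have "\<dots> = (\<Sum>k<Suc N. (if k = i then M $$ (k, j) else 0)
        + (if i \<noteq> 0 \<and> k = 0 then M $$ (k, j) else 0))"
      by (intro sum.cong) auto
    also have "\<dots> = (if i = 0 then M $$ (0, j) else M $$ (0, j) + M $$ (i, j))"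
      using that unfolding sum.distrib by (auto simp: sum.delta simp del: sum.lessThan_Suc)
    finally show ?thesis .
  qed
  \<comment> \<open>\<open>Q\<close> subtracts all other columns from column 0. Twice the first
    entry minus a full row sum is a form into which the row sums of \<open>A\<close> can be
    substituted.\<close>
  have mult_Q: "(M * Q) $$ (i, j) =
      (if j = 0 then 2 * M $$ (i, 0) - (\<Sum>k<Suc N. M $$ (i, k)) else M $$ (i, j))"
    if "i < Suc N" "j < Suc N" and M: "M \<in> carrier_mat (Suc N) (Suc N)" for M i j
  proof -
    have "(M * Q) $$ (i, j) = (\<Sum>k<Suc N. M $$ (i, k) * (if k = j then 1 else if j = 0 then - 1 else 0))"
      using that by (simp add: Q_def scalar_prod_def atLeast0LessThan)
    also have "\<dots> = (\<Sum>k<Suc N. (if k = j then (if j = 0 then 2 else 1) * M $$ (i, k) else 0)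
        - (if j = 0 then M $$ (i, k) else 0))"
      by (intro sum.cong) auto
    also have "\<dots> = (if j = 0 then 2 * M $$ (i, 0) - (\<Sum>k<Suc N. M $$ (i, k)) else M $$ (i, j))"
      using that unfolding sum_subtractf by (auto simp: sum.delta simp del: sum.lessThan_Suc)
    finally show ?thesis .
  qed
  have PQ: "P * Q = 1\<^sub>m (Suc N)"
  proof (rule eq_matI)
    fix i j assume "i < dim_row (1\<^sub>m (Suc N) :: complex mat)" "j < dim_col (1\<^sub>m (Suc N) :: complex mat)"
    then have ij: "i < Suc N" "j < Suc N" by auto
    show "(P * Q) $$ (i, j) = 1\<^sub>m (Suc N) $$ (i, j)"
      unfolding P_mult[OF ij carr(3)] using ij by (auto simp: Q_def)
  qed (use carr in auto)
  have QP: "Q * P = 1\<^sub>m (Suc N)"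
    using mat_mult_left_right_inverse[OF carr(2,3) PQ] .
  have PT: "P * T \<in> carrier_mat (Suc N) (Suc N)" using carr by simp
  have PTe: "(P * T) $$ (i, j) = (if j = 0 then 0 else A $$ (i, j))"
    if "i < Suc N" "j < Suc N" for i j
    using that carr unfolding P_mult[OF that carr(1)] by (auto simp: T_def)
  have "A = P * T * Q"
  proof (rule eq_matI)
    fix i j assume "i < dim_row (P * T * Q)" "j < dim_col (P * T * Q)"
    then have ij: "i < Suc N" "j < Suc N" using carr by auto
    have "(\<Sum>k<Suc N. (P * T) $$ (i, k)) = (\<Sum>k<Suc N. A $$ (i, k) - (if k = 0 then A $$ (i, 0) else 0))"
      using ij by (intro sum.cong) (auto simp: PTe)
    also have "\<dots> = - A $$ (i, 0)"
      unfolding sum_subtractf rows[OF ij(1)] by (simp del: sum.lessThan_Suc)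
    finally show "A $$ (i, j) = (P * T * Q) $$ (i, j)"
      unfolding mult_Q[OF ij PT] using ij by (simp add: PTe del: sum.lessThan_Suc)
  qed (use A carr in auto)
  then have "similar_mat A T"
    using A carr PQ QP by (intro similar_matI[of _ _ P Q "Suc N"]) auto
  then have "char_poly A = char_poly T" by (rule char_poly_similar)
  also have "\<dots> = monom 1 1 * char_poly (mat_delete T 0 0)"
    by (rule char_poly_0_column[OF _ carr(1)]) (auto simp: T_def)
  also have "mat_delete T 0 0 = B"
    by (rule eq_matI) (auto simp: T_def B_def mat_delete_def)
  finally show ?thesis by (simp add: x_as_monom)
qed

text \<open>\<open>const\<close> excludes further kernel vectors as well as generalised eigenvectors
  above the all-ones vector, so 0 is an algebraically simple root. Eigenvectors of the reduced
  matrix \<open>B\<close> lift to eigenvectors of \<open>A\<close>.\<close>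

lemma proots_char_poly_zero_row_sums:
  fixes A :: "complex mat"
  assumes A: "A \<in> carrier_mat N N" and N: "N > 0"
    and rows: "\<And>i. i < N \<Longrightarrow> (\<Sum>k<N. A $$ (i, k)) = 0"
    and const: "\<And>v c. v \<in> carrier_vec N \<Longrightarrow> (\<And>i. i < N \<Longrightarrow> (A *\<^sub>v v) $ i = c)
      \<Longrightarrow> \<forall>i<N. v $ i = v $ 0"
  shows "\<exists>M. proots (char_poly A) = add_mset 0 M \<and> (\<forall>z\<in>#M. z \<noteq> 0 \<and> eigenvalue A z)"
proof -
  obtain n where n: "N = Suc n" using N by (cases N) auto
  define B where "B = mat n n (\<lambda>(i, j). A $$ (Suc i, Suc j) - A $$ (0, Suc j))"
  have B: "B \<in> carrier_mat n n" by (simp add: B_def)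
  have cp: "char_poly A = [:0, 1:] * char_poly B"
    using char_poly_zero_row_sums[of A n] A rows unfolding n B_def by blast
  have "monic (char_poly B)" using degree_monic_char_poly[OF B] by simp
  then have nz: "char_poly B \<noteq> 0" by auto
  have "proots (char_poly A) = add_mset 0 (proots (char_poly B))"
    unfolding cp by (subst proots_mult) (use nz in auto)
  moreover have "z \<noteq> 0 \<and> eigenvalue A z" if z: "z \<in># proots (char_poly B)" for z
  proof -
    have "eigenvalue B z"
      using z nz by (simp add: eigenvalue_root_char_poly[OF B])
    then obtain y where y: "y \<in> carrier_vec n" "y \<noteq> 0\<^sub>v n" "B *\<^sub>v y = z \<cdot>\<^sub>v y"
      using B by (auto simp: eigenvalue_def eigenvector_def)
    \<comment> \<open>\<open>y\<close> padded with a 0 in front. The rows of \<open>B\<close> are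
      differences against row 0 of \<open>A\<close>, so \<open>A x\<close> agrees with
      \<open>z x\<close> up to the additive constant \<open>c\<close>.\<close>
    define x where "x = vec N (case_nat 0 (($) y))"
    define c where "c = (A *\<^sub>v x) $ 0"
    have x: "x \<in> carrier_vec N" by (simp add: x_def)
    have x0: "x $ 0 = 0" using N by (simp add: x_def)
    have Ax_sum: "(A *\<^sub>v x) $ i = (\<Sum>k<n. A $$ (i, Suc k) * y $ k)" if "i < N" for i
    proof -
      have "(A *\<^sub>v x) $ i = (\<Sum>k<Suc n. A $$ (i, k) * x $ k)"
        using that A by (simp add: x_def scalar_prod_def n atLeast0LessThan del: sum.lessThan_Suc)
      then show ?thesis unfolding sum.lessThan_Suc_shift by (simp add: x_def n)
    qed
    have Ax: "(A *\<^sub>v x) $ i = c + z * x $ i" if i: "i < N" for i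
    proof (cases i)
      case 0
      then show ?thesis by (simp add: c_def x0)
    next
      case (Suc j)
      then have j: "j < n" using i n by simp
      have "z * y $ j = (B *\<^sub>v y) $ j" using y(1,3) j by simp
      also have "\<dots> = (\<Sum>k<n. (A $$ (i, Suc k) - A $$ (0, Suc k)) * y $ k)"
        using j y(1) by (simp add: B_def scalar_prod_def atLeast0LessThan Suc)
      also have "\<dots> = (A *\<^sub>v x) $ i - c"
        unfolding c_def using i N by (simp add: Ax_sum sum_subtractf left_diff_distrib)
      finally show ?thesis using Suc i by (simp add: x_def)
    qed
    have y0: False if "\<forall>i<N. x $ i = x $ 0"
    proof -
      have "y $ j = 0" if "j < n" for j
        using \<open>\<forall>i<N. x $ i = x $ 0\<close>[rule_format, of "Suc j"] x0 that by (simp add: x_def n)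
      then show False using y(1,2) by auto
    qed
    \<comment> \<open>For \<open>z = 0\<close> the vector \<open>A x\<close> would be constant, so
      \<open>const\<close> would make \<open>x\<close> constant, hence zero because its first entry
      is 0.\<close>
    have "z \<noteq> 0"
      using Ax const[OF x, of c] y0 by auto
    moreover have "eigenvalue A z"
    proof -
      \<comment> \<open>\<open>A\<close> kills constants, so the shift by \<open>c / z\<close>
        leaves \<open>A x\<close> unchanged and absorbs the constant \<open>c\<close>.\<close>
      define v where "v = vec N (\<lambda>i. x $ i + c / z)"
      have v: "v \<in> carrier_vec N" by (simp add: v_def)
      have "(A *\<^sub>v v) $ i = z * v $ i" if i: "i < N" for i
      proof -
        have "(A *\<^sub>v v) $ i = (\<Sum>k<N. A $$ (i, k) * (x $ k + c / z))"
          using i A by (simp add: v_def scalar_prod_def atLeast0LessThan)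
        also have "\<dots> = (\<Sum>k<N. A $$ (i, k) * x $ k) + (\<Sum>k<N. A $$ (i, k)) * (c / z)"
          by (simp add: ring_distribs sum.distrib sum_distrib_right del: times_divide_eq_right)
        also have "\<dots> = (A *\<^sub>v x) $ i"
          using i A x rows by (simp add: scalar_prod_def atLeast0LessThan)
        finally show ?thesis using Ax[OF i] i \<open>z \<noteq> 0\<close> by (simp add: v_def field_simps)
      qed
      then have "A *\<^sub>v v = z \<cdot>\<^sub>v v" using A v by (intro eq_vecI) auto
      moreover have "v \<noteq> 0\<^sub>v N"
      proof
        assume "v = 0\<^sub>v N"
        then have "x $ i + c / z = 0" if "i < N" for i
          using that by (metis v_def index_vec index_zero_vec(1))
        then have "\<forall>i<N. x $ i = x $ 0" using N by (metis add_right_cancel)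
        then show False by (rule y0)
      qed
      ultimately show ?thesis using A v by (auto simp: eigenvalue_def eigenvector_def)
    qed
    ultimately show ?thesis by blast
  qed
  ultimately show ?thesis by blast
qed

section \<open>Locating \<open>lambda2\<close> in the sorted list of real parts\<close>

lemma sorted_nth_1_le:
  fixes xs :: "real list"
  assumes "sorted xs" and "{#a, b#} \<subseteq># mset xs" and "a \<le> \<mu>" and "b \<le> \<mu>"
  shows "xs ! 1 \<le> \<mu>"
proof (rule ccontr)
  assume gt: "\<not> xs ! 1 \<le> \<mu>"
  have "size {#a, b#} \<le> size (mset xs)" using assms(2) by (rule size_mset_mono)
  then obtain p q zs where xs: "xs = p # q # zs"
    by (cases xs; cases "tl xs") auto
  then have le: "q \<le> x" if "x \<in> set zs" for x
    using assms(1) that by simp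
  have "filter_mset (\<lambda>x. x \<le> \<mu>) {#a, b#} \<subseteq># filter_mset (\<lambda>x. x \<le> \<mu>) (mset xs)"
    using assms(2) by (rule multiset_filter_mono)
  then have "size {#a, b#} \<le> size (filter_mset (\<lambda>x. x \<le> \<mu>) (mset xs))"
    using assms(3,4) by (auto dest: size_mset_mono)
  moreover have "filter_mset (\<lambda>x. x \<le> \<mu>) (mset (q # zs)) = {#}"
    using gt le unfolding xs by (fastforce simp: multiset_eq_iff count_eq_zero_iff)
  then have "size (filter_mset (\<lambda>x. x \<le> \<mu>) (mset xs)) \<le> 1"
    unfolding xs by simp
  ultimately show False by simp
qed

text \<open>Distinct eigenvalues occupy two places of the list whatever their multiplicities. Taking
  0 as one of them, any eigenvalue of positive real part bounds \<open>lambda2\<close> from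
  above.\<close>

lemma lambda2_le:
  assumes A: "A \<in> carrier_mat N N"
    and "eigenvalue (cmat A) z" "eigenvalue (cmat A) w" "z \<noteq> w" "Re z \<le> \<mu>" "Re w \<le> \<mu>"
  shows "lambda2 A \<le> \<mu>"
proof -
  have A': "cmat A \<in> carrier_mat N N" using A by (simp add: cmat_def)
  have "monic (char_poly (cmat A))" using degree_monic_char_poly[OF A'] by simp
  then have nz: "char_poly (cmat A) \<noteq> 0" by auto
  then have "z \<in># proots (char_poly (cmat A))" "w \<in># proots (char_poly (cmat A))"
    using assms(2,3) by (auto simp: eigenvalue_root_char_poly[OF A'])
  then have "{#z, w#} \<subseteq># proots (char_poly (cmat A))"
    using \<open>z \<noteq> w\<close> by (metis insert_DiffM insert_noteq_member mset_subset_eq_add_mset_cancel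
        mset_subset_eq_single)
  then have "image_mset Re {#z, w#} \<subseteq># image_mset Re (proots (char_poly (cmat A)))"
    by (rule image_mset_subseteq_mono)
  then show ?thesis unfolding lambda2_def sorted_spectrum_def
    using assms(5,6) by (intro sorted_nth_1_le[of _ "Re z" "Re w"]) auto
qed

text \<open>By nonnegativity the simple root 0 can be listed first, so index 1 comes from a nonzero
  eigenvalue. This turns lower bounds on the nonzero eigenvalues into lower bounds on
  \<open>lambda2\<close>.\<close>

lemma lambda2_zero_row_sums:
  assumes A: "A \<in> carrier_mat N N" and N: "N \<ge> 2"
    and rows: "\<And>i. i < N \<Longrightarrow> (\<Sum>k<N. A $$ (i, k)) = 0"
    and const: "\<And>v c. v \<in> carrier_vec N \<Longrightarrow> (\<And>i. i < N \<Longrightarrow> (cmat A *\<^sub>v v) $ i = c)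
      \<Longrightarrow> \<forall>i<N. v $ i = v $ 0"
    and nonneg: "\<And>z. eigenvalue (cmat A) z \<Longrightarrow> 0 \<le> Re z"
  shows "\<exists>z. z \<noteq> 0 \<and> eigenvalue (cmat A) z \<and> lambda2 A = Re z"
proof -
  have A': "cmat A \<in> carrier_mat N N" using A by (simp add: cmat_def)
  have rows': "(\<Sum>k<N. cmat A $$ (i, k)) = 0" if "i < N" for i
  proof -
    have "(\<Sum>k<N. cmat A $$ (i, k)) = complex_of_real (\<Sum>k<N. A $$ (i, k))"
      using that A by (simp add: cmat_def)
    then show ?thesis using rows[OF that] by simp
  qed
  have "\<exists>M. proots (char_poly (cmat A)) = add_mset 0 M \<and>
      (\<forall>z\<in>#M. z \<noteq> 0 \<and> eigenvalue (cmat A) z)"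
    using N by (intro proots_char_poly_zero_row_sums[OF A'] rows' const) auto
  then obtain M where M: "proots (char_poly (cmat A)) = add_mset 0 M"
    "\<And>z. z \<in># M \<Longrightarrow> z \<noteq> 0 \<and> eigenvalue (cmat A) z"
    by blast
  have "size (proots (char_poly (cmat A))) = N"
    using degree_monic_char_poly[OF A'] by (simp add: size_proots_complex)
  then have "M \<noteq> {#}" using N M(1) by auto
  define xs where "xs = sorted_list_of_multiset (image_mset Re M)"
  have xs: "mset xs = image_mset Re M" "sorted xs" by (simp_all add: xs_def)
  have set: "set xs = Re ` set_mset M" by (metis set_mset_mset xs(1) set_image_mset)
  have "sorted_spectrum A = 0 # xs"
  proof -
    have "sorted (0 # xs)" using xs(2) set M(2) nonneg by auto
    moreover have "mset (0 # xs) = image_mset Re (proots (char_poly (cmat A)))"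
      by (simp add: M(1) xs(1))
    ultimately show ?thesis unfolding sorted_spectrum_def
      by (metis sorted_list_of_multiset_mset sorted_sort_id)
  qed
  moreover have "xs \<noteq> []" using \<open>M \<noteq> {#}\<close> xs(1) by auto
  ultimately have "lambda2 A \<in> set xs" by (simp add: lambda2_def hd_conv_nth[symmetric])
  then show ?thesis using set M(2) by auto
qed

subsection \<open>Cycle and star components\<close>

lemma L_Gp_carrier: "L_Gp n m \<delta> \<in> carrier_mat (n + m) (n + m)"
  by (auto simp: L_Gp_def L_cycle_def L_star_def corner_def)

lemma L_cycle_row:
  assumes n: "n \<ge> 3" and i: "i < n"
  shows "(\<Sum>k<n. complex_of_real (L_cycle n $$ (i, k)) * x k)
    = 2 * x i - x ((i + 1) mod n) - x ((i + n - 1) mod n)"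
proof -
  have s: "k < n \<Longrightarrow> (i = (k + 1) mod n) = (k = (i + n - 1) mod n)" for k
    using n i by (cases "k + 1 = n"; cases "i = 0") (auto simp: mod_if)
  \<comment> \<open>\<open>n \<ge> 3\<close> keeps the two neighbours of a node distinct, so that no
    edge is counted twice.\<close>
  have ne: "(i + 1) mod n \<noteq> (i + n - 1) mod n" "(i + 1) mod n \<noteq> i" "(i + n - 1) mod n \<noteq> i"
    using n i by (auto simp: mod_if)
  have lt: "(i + 1) mod n < n" "(i + n - 1) mod n < n"
    using n by auto
  have "(\<Sum>k<n. complex_of_real (L_cycle n $$ (i, k)) * x k)
    = (\<Sum>k<n. (if k = i then 2 * x k else 0) - (if k = (i + 1) mod n then x k else 0)
        - (if k = (i + n - 1) mod n then x k else 0))"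
    using ne i s by (intro sum.cong) (auto simp: L_cycle_def)
  also have "\<dots> = 2 * x i - x ((i + 1) mod n) - x ((i + n - 1) mod n)"
    using lt i unfolding sum_subtractf by (simp add: sum.delta)
  finally show ?thesis .
qed

text \<open>Indices below \<open>n\<close> are cycle nodes, \<open>n\<close> is the hub, larger ones
  are leaves. The hub coefficient \<open>m\<close> is made up of \<open>m - 1\<close> leaves and the
  edge coming from the cycle.\<close>

lemma L_Gp_mult_vec:
  fixes \<delta> :: real
  assumes n: "n \<ge> 3" and m: "m > 0" and v: "v \<in> carrier_vec (n + m)"
  defines "w \<equiv> cmat (L_Gp n m \<delta>) *\<^sub>v v"
  shows "i < n \<Longrightarrow> w $ i = 2 * v $ i - v $ ((i + 1) mod n) - v $ ((i + n - 1) mod n)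
      + (if i = 0 then \<delta> * (v $ 0 - v $ n) else 0)"
    and "w $ n = m * v $ n - (\<Sum>j\<in>{1..<m}. v $ (n + j)) - v $ 0"
    and "1 \<le> j \<Longrightarrow> j < m \<Longrightarrow> w $ (n + j) = v $ (n + j) - v $ n"
proof -
  let ?A = "cmat (L_Gp n m \<delta>)"
  have split: "(\<Sum>k<n + m. f k) = (\<Sum>k<n. f k) + (\<Sum>k<m. f (n + k))" for f :: "nat \<Rightarrow> complex"
    by (induction m) (simp_all add: add.assoc)
  have A: "?A \<in> carrier_mat (n + m) (n + m)"
    using L_Gp_carrier by (simp add: cmat_def)
  have w: "w $ i = (\<Sum>k<n. ?A $$ (i, k) * v $ k) + (\<Sum>k<m. ?A $$ (i, n + k) * v $ (n + k))"
    if "i < n + m" for i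
    unfolding split[symmetric, of "\<lambda>k. ?A $$ (i, k) * v $ k"] w_def
    using that v A by (simp add: scalar_prod_def atLeast0LessThan)
  have range: "{..<m} = insert 0 {1..<m}" using m by auto
  show "w $ i = 2 * v $ i - v $ ((i + 1) mod n) - v $ ((i + n - 1) mod n)
      + (if i = 0 then \<delta> * (v $ 0 - v $ n) else 0)" if i: "i < n"
  proof -
    have "(\<Sum>k<n. ?A $$ (i, k) * v $ k) = (\<Sum>k<n. complex_of_real (L_cycle n $$ (i, k)) * v $ k
        + (if k = 0 then if i = 0 then \<delta> * v $ 0 else 0 else 0))"
      using i by (intro sum.cong)
        (auto simp: cmat_def L_Gp_def L_cycle_def corner_def L_star_def ring_distribs)
    moreover have "(\<Sum>k<m. ?A $$ (i, n + k) * v $ (n + k))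
      = (\<Sum>k<m. if k = 0 then if i = 0 then - \<delta> * v $ n else 0 else 0)"
      using i by (intro sum.cong)
        (auto simp: cmat_def L_Gp_def L_cycle_def corner_def L_star_def ring_distribs)
    ultimately show ?thesis
      using i m n by (simp add: w sum.distrib L_cycle_row ring_distribs del: times_divide_eq_right)
  qed
  show "w $ n = m * v $ n - (\<Sum>j\<in>{1..<m}. v $ (n + j)) - v $ 0"
  proof -
    have "(\<Sum>k<n. ?A $$ (n, k) * v $ k) = (\<Sum>k<n. if k = 0 then - v $ 0 else 0)"
      using m by (intro sum.cong)
        (auto simp: cmat_def L_Gp_def L_cycle_def corner_def L_star_def)
    moreover have "(\<Sum>k<m. ?A $$ (n, n + k) * v $ (n + k))
      = m * v $ n + (\<Sum>k\<in>{1..<m}. - v $ (n + k))"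
      unfolding range using m
      by (subst sum.insert)
        (auto simp: cmat_def L_Gp_def L_cycle_def corner_def L_star_def intro!: sum.cong)
    ultimately show ?thesis
      using m n by (simp add: w sum_negf)
  qed
  show "w $ (n + j) = v $ (n + j) - v $ n" if j: "1 \<le> j" "j < m"
  proof -
    have "(\<Sum>k<n. ?A $$ (n + j, k) * v $ k) = 0"
      using j by (intro sum.neutral)
        (auto simp: cmat_def L_Gp_def L_cycle_def corner_def L_star_def)
    moreover have "(\<Sum>k<m. ?A $$ (n + j, n + k) * v $ (n + k))
      = (\<Sum>k<m. (if k = j then v $ (n + k) else 0) - (if k = 0 then v $ (n + k) else 0))"
      using j by (intro sum.cong)
        (auto simp: cmat_def L_Gp_def L_cycle_def corner_def L_star_def)
    ultimately show ?thesis
      using m j by (simp add: w sum_subtractf)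
  qed
qed

text \<open>Centring the row at \<open>k + 1\<close> avoids subtraction on indices; node 0, the only
  coupled one, then appears at \<open>k + 1 = n\<close>.\<close>

lemma L_Gp_mult_vec_cyclic:
  fixes \<delta> :: real
  assumes n: "n \<ge> 3" and m: "m > 0" and v: "v \<in> carrier_vec (n + m)" and k: "k < n"
  defines "X \<equiv> \<lambda>k. v $ (k mod n)"
  shows "2 * X (k + 1) - X (k + 2) - X k = (cmat (L_Gp n m \<delta>) *\<^sub>v v) $ ((k + 1) mod n)
      - (if k + 1 = n then \<delta> * (X 0 - v $ n) else 0)"
proof -
  have lt: "(k + 1) mod n < n" using n by simp
  have "((k + 1) mod n + 1) mod n = (k + 2) mod n" by (simp add: mod_Suc_eq)
  moreover have "((k + 1) mod n + n - 1) mod n = k" using k n by (auto simp: mod_if)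
  moreover have "((k + 1) mod n = 0) = (k + 1 = n)" using k by (auto simp: mod_if)
  ultimately show ?thesis
    unfolding L_Gp_mult_vec(1)[OF n m v lt] using k by (simp add: X_def)
qed

text \<open>Summing the cycle rows gives \<open>n c = \<delta> (v $ 0 - v $ n)\<close>, and the star
  rows give \<open>v $ n - v $ 0 = m c\<close>. Together \<open>(n + \<delta> m) c = 0\<close>, so
  \<open>c = 0\<close>. The case \<open>\<delta> = 0\<close> is included in order to cover
  \<open>L_G\<close>.\<close>

lemma L_Gp_mult_vec_const:
  fixes \<delta> :: real
  assumes n: "n \<ge> 3" and m: "m > 0" and \<delta>: "\<delta> \<ge> 0" and v: "v \<in> carrier_vec (n + m)"
    and c: "\<And>i. i < n + m \<Longrightarrow> (cmat (L_Gp n m \<delta>) *\<^sub>v v) $ i = c"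
  shows "\<forall>i<n + m. v $ i = v $ 0"
proof -
  define X where "X = (\<lambda>k. v $ (k mod n))"
  have per: "X n = X 0" "X (n + 1) = X 1" using n by (simp_all add: X_def mod_Suc)
  have cyc: "2 * X (k + 1) - X (k + 2) - X k = c - (if k + 1 = n then \<delta> * (X 0 - v $ n) else 0)"
    if "k < n" for k
    using L_Gp_mult_vec_cyclic[OF n m v that, of \<delta>] n c[of "(k + 1) mod n"] unfolding X_def
    by (simp add: trans_less_add1)
  have hub: "m * v $ n - (\<Sum>j\<in>{1..<m}. v $ (n + j)) - v $ 0 = c"
    using L_Gp_mult_vec(2)[OF n m v, of \<delta>] c[of n] m by simp
  have leaf: "v $ (n + j) = c + v $ n" if "1 \<le> j" "j < m" for j
    using L_Gp_mult_vec(3)[OF n m v that, of \<delta>] c[of "n + j"] that by simp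
  have X0: "X 0 = v $ 0" by (simp add: X_def)
  \<comment> \<open>Second differences of a periodic sequence telescope to 0, leaving only the
    coupling term at node 0.\<close>
  have "(\<Sum>k<n. 2 * X (k + 1) - X (k + 2) - X k) = (\<Sum>k<n. (X (k + 1) - X k) - (X (Suc k + 1) - X (Suc k)))"
    by (intro sum.cong) auto
  also have "\<dots> = 0" using per by (subst sum_lessThan_telescope') simp
  also have "(\<Sum>k<n. 2 * X (k + 1) - X (k + 2) - X k)
      = (\<Sum>k<n. c - (if k = n - 1 then \<delta> * (X 0 - v $ n) else 0))"
    using n by (intro sum.cong refl, subst cyc) auto
  finally have "(\<Sum>k<n. c - (if k = n - 1 then \<delta> * (X 0 - v $ n) else 0)) = 0" .
  then have 1: "n * c = \<delta> * (v $ 0 - v $ n)"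
    using n unfolding sum_subtractf X0 by simp
  have "(\<Sum>j\<in>{1..<m}. v $ (n + j)) = (\<Sum>j\<in>{1..<m}. c + v $ n)"
    by (intro sum.cong) (auto simp: leaf)
  then have 2: "v $ n - v $ 0 = m * c"
    using hub m by (simp add: of_nat_diff algebra_simps)
  have "(n + \<delta> * m) * c = 0"
    using 1 2 by (simp add: algebra_simps)
  moreover have "real n + \<delta> * m > 0" using n \<delta> by (simp add: add_pos_nonneg)
  then have "complex_of_real (real n + \<delta> * m) \<noteq> 0" by (metis less_irrefl of_real_eq_0_iff)
  then have "(n + \<delta> * m) * c = 0 \<Longrightarrow> c = 0" by simp
  ultimately have c0: "c = 0" by blast
  have hub0: "v $ n = v $ 0" using 2 c0 by simp
  have leaf0: "v $ (n + j) = v $ 0" if "j < m" for j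
    using leaf[of j] that hub0 c0 by (cases "j = 0") auto
  \<comment> \<open>With \<open>c = 0\<close> and equal values at hub and node 0, all second
    differences vanish. The cycle part is then an arithmetic progression, and periodicity forces
    \<open>d = 0\<close>.\<close>
  define d where "d = X 1 - X 0"
  have diff: "X (k + 1) - X k = d" if "k \<le> n" for k
    using that
  proof (induction k)
    case (Suc k)
    have "2 * X (k + 1) - X (k + 2) - X k = 0"
      using cyc[of k] Suc.prems c0 X0 hub0 by simp
    then show ?case using Suc by (simp add: algebra_simps)
  qed (simp add: d_def)
  have lin: "X k = X 0 + k * d" if "k \<le> n" for k
    using that by (induction k) (use diff in \<open>auto simp: algebra_simps\<close>)
  have "d = 0" using lin[of n] per n by simp
  then have cycle0: "v $ k = v $ 0" if "k < n" for k
    using lin[of k] that by (simp add: X_def)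
  show ?thesis
  proof (intro allI impI)
    fix i assume "i < n + m"
    then show "v $ i = v $ 0"
      using cycle0[of i] leaf0[of "i - n"] by (cases "i < n") auto
  qed
qed

text \<open>The recurrence has characteristic roots \<open>w\<close> and \<open>1 / w\<close>.
  Removing one root at a time makes \<open>Z\<close> geometric with ratio \<open>w\<close>, then
  \<open>X\<close> geometric with ratio \<open>1 / w\<close>; periodicity with
  \<open>w ^ n \<noteq> 1\<close> kills each in turn. This also covers the double root
  \<open>w = - 1\<close>.\<close>

lemma cycle_recurrence_zero:
  fixes X :: "nat \<Rightarrow> complex"
  assumes per: "X n = X 0" "X (n + 1) = X 1"
    and cyc: "\<And>k. k < n \<Longrightarrow> 2 * X (k + 1) - X (k + 2) - X k = z * X (k + 1)"
    and w: "w \<noteq> 0" "w + 1 / w = 2 - z" and wn: "w ^ n \<noteq> 1" and k: "k \<le> n"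
  shows "X k = 0"
proof -
  define Z where "Z k = X (k + 1) - X k / w" for k
  have ZS: "Z (Suc k) = w * Z k" if "k < n" for k
  proof -
    have "X (k + 2) = (2 - z) * X (k + 1) - X k"
      using cyc[OF that] by (simp add: algebra_simps)
    then have "Z (Suc k) = (w + 1 / w) * X (k + 1) - X k - X (k + 1) / w"
      unfolding w(2) by (simp add: Z_def)
    then have "Z (Suc k) = w * X (k + 1) - X k" by (simp add: ring_distribs)
    then show ?thesis using w(1) by (simp add: Z_def right_diff_distrib)
  qed
  have Z: "Z k = w ^ k * Z 0" if "k \<le> n" for k
    using that by (induction k) (auto simp: ZS)
  have "Z n = Z 0" using per by (simp add: Z_def)
  then have "Z 0 = 0" using Z[of n] wn by simp
  then have XS: "X (Suc k) = X k / w" if "k \<le> n" for k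
    using Z[OF that] by (simp add: Z_def)
  have X: "X k = X 0 / w ^ k" if "k \<le> n" for k
    using that by (induction k) (auto simp: XS)
  have "X 0 = 0" using X[of n] per wn w by (simp add: field_simps)
  then show ?thesis using X[OF k] by simp
qed

text \<open>A nonzero periodic solution forces \<open>w\<close> to be an \<open>n\<close>-th root of
  unity, and then \<open>z = 2 - w - 1 / w\<close> is one of the cycle eigenvalues.\<close>

lemma cycle_spectrum:
  fixes X :: "nat \<Rightarrow> complex"
  assumes n: "n > 0" and per: "X n = X 0" "X (n + 1) = X 1"
    and cyc: "\<And>k. k < n \<Longrightarrow> 2 * X (k + 1) - X (k + 2) - X k = z * X (k + 1)"
    and k: "k \<le> n" "X k \<noteq> 0"
  shows "\<exists>j<n. z = alpha n (2 * j)"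
proof -
  \<comment> \<open>A root of \<open>w\<^sup>2 - (2 - z) w + 1\<close> by the quadratic formula; it
    is nonzero because the constant term is 1.\<close>
  define w where "w = (2 - z + csqrt ((2 - z)\<^sup>2 - 4)) / 2"
  have "2 * w - (2 - z) = csqrt ((2 - z)\<^sup>2 - 4)" by (simp add: w_def add_divide_distrib diff_divide_distrib)
  then have "(2 * w - (2 - z))\<^sup>2 = (2 - z)\<^sup>2 - 4" by simp
  then have "4 * (w * w + 1) = 4 * ((2 - z) * w)" by (simp add: power2_eq_square algebra_simps)
  then have q: "w * w + 1 = (2 - z) * w" by (subst (asm) mult_left_cancel) simp_all
  then have w0: "w \<noteq> 0" by auto
  then have w1: "w + 1 / w = 2 - z" using q by (simp add: field_simps)
  have "w ^ n = 1" using cycle_recurrence_zero[OF per cyc w0 w1 _ k(1)] k(2) by blast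
  then obtain j where j: "j < n" "w = cis (2 * pi * j / n)"
    using bij_betw_roots_unity[OF n] by (force simp: bij_betw_def)
  have "z = 2 - (w + 1 / w)" using w1 by simp
  also have "1 / w = cis (- (2 * pi * j / n))" unfolding j(2) divide_inverse cis_inverse by simp
  also have "2 - (w + cis (- (2 * pi * j / n))) = alpha n (2 * j)"
    by (simp add: complex_eq_iff j alpha_def mult.commute mult.left_commute)
  finally show ?thesis using j(1) by auto
qed

text \<open>Cosine decreases on \<open>[0, pi]\<close>; an index past \<open>n / 2\<close> is
  reflected to \<open>n - j\<close>, which does not change the cosine.\<close>

lemma alpha_even_ge:
  assumes "1 \<le> j" "j < n"
  shows "alpha n (2 * j) \<ge> alpha n 2"
proof -
  have *: "cos (2 * i * pi / n) \<le> cos (2 * pi / n)" if "1 \<le> i" "2 * i \<le> n" for i :: nat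
  proof (rule cos_monotone_0_pi_le)
    have n: "real n > 0" using that by simp
    show "2 * pi / n \<le> 2 * i * pi / n" using that n by (intro divide_right_mono) auto
    show "2 * i * pi / n \<le> pi" using that n by (simp add: divide_le_eq mult.commute flip: of_nat_mult)
  qed simp
  have "cos (2 * j * pi / n) \<le> cos (2 * pi / n)"
  proof (cases "2 * j \<le> n")
    case False
    have "2 * real (n - j) * pi / n = 2 * pi - 2 * j * pi / n"
      using assms by (simp add: of_nat_diff field_simps)
    then have "cos (2 * j * pi / n) = cos (2 * real (n - j) * pi / n)"
      by (simp add: cos_diff)
    then show ?thesis using *[of "n - j"] assms False by simp
  qed (use * assms in simp)
  then show ?thesis by (simp add: alpha_def)
qed

text \<open>The leaves are eliminated by multiplying the hub equation by \<open>1 - z\<close>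
  instead of dividing by it, so \<open>z = 1\<close> stays admissible. The quadratic is the one with
  smaller root \<open>beta_minus m\<close>.\<close>

lemma star_equation:
  fixes b z x :: complex and y :: "nat \<Rightarrow> complex"
  assumes m: "m > 0" and hub: "m * b - (\<Sum>j\<in>{1..<m}. y j) - x = z * b"
    and leaf: "\<And>j. 1 \<le> j \<Longrightarrow> j < m \<Longrightarrow> y j - b = z * y j"
  shows "(z\<^sup>2 - (m + 1) * z + 1) * b = (1 - z) * x"
proof -
  have "(1 - z) * (\<Sum>j\<in>{1..<m}. y j) = (\<Sum>j\<in>{1..<m}. b)"
    unfolding sum_distrib_left by (intro sum.cong) (use leaf in \<open>auto simp: algebra_simps\<close>)
  then have "(1 - z) * (\<Sum>j\<in>{1..<m}. y j) = (of_nat m - 1) * b"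
    using m by (simp add: of_nat_diff)
  moreover have "(\<Sum>j\<in>{1..<m}. y j) = (m - z) * b - x"
    using hub by (simp add: algebra_simps)
  ultimately have "(1 - z) * ((m - z) * b - x) = (of_nat m - 1) * b" by simp
  then show ?thesis by (simp add: power2_eq_square algebra_simps)
qed

subsection \<open>Spectra of the two Laplacians\<close>

lemma L_Gp_eigenvalueE:
  fixes \<delta> :: real and z :: complex
  assumes n: "n \<ge> 3" and m: "m > 0" and ev: "eigenvalue (cmat (L_Gp n m \<delta>)) z"
  obtains X :: "nat \<Rightarrow> complex" and b :: complex and y :: "nat \<Rightarrow> complex"
  where "X n = X 0" "X (n + 1) = X 1"
    and "\<And>k. k < n \<Longrightarrow> 2 * X (k + 1) - X (k + 2) - X k
          = z * X (k + 1) - (if k + 1 = n then \<delta> * (X 0 - b) else 0)"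
    and "m * b - (\<Sum>j\<in>{1..<m}. y j) - X 0 = z * b"
    and "\<And>j. 1 \<le> j \<Longrightarrow> j < m \<Longrightarrow> y j - b = z * y j"
    and "(\<exists>k<n. X k \<noteq> 0) \<or> b \<noteq> 0 \<or> (\<exists>j\<in>{1..<m}. y j \<noteq> 0)"
proof -
  have A: "cmat (L_Gp n m \<delta>) \<in> carrier_mat (n + m) (n + m)"
    using L_Gp_carrier by (simp add: cmat_def)
  obtain v where v: "v \<in> carrier_vec (n + m)" "v \<noteq> 0\<^sub>v (n + m)"
      "cmat (L_Gp n m \<delta>) *\<^sub>v v = z \<cdot>\<^sub>v v"
    using ev A by (auto simp: eigenvalue_def eigenvector_def)
  define X where "X = (\<lambda>k. v $ (k mod n))"
  have Av: "(cmat (L_Gp n m \<delta>) *\<^sub>v v) $ i = z * v $ i" if "i < n + m" for i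
    using v that by simp
  show thesis
  proof (rule that[of X "v $ n" "\<lambda>j. v $ (n + j)"])
    show "X n = X 0" "X (n + 1) = X 1" using n by (simp_all add: X_def mod_Suc)
    show "2 * X (k + 1) - X (k + 2) - X k
        = z * X (k + 1) - (if k + 1 = n then \<delta> * (X 0 - v $ n) else 0)" if "k < n" for k
    proof -
      have "(k + 1) mod n < n + m" using n by (simp add: trans_less_add1)
      then show ?thesis
        using L_Gp_mult_vec_cyclic[OF n m v(1) that, of \<delta>] unfolding X_def by (simp only: Av)
    qed
    show "m * v $ n - (\<Sum>j\<in>{1..<m}. v $ (n + j)) - X 0 = z * v $ n"
      using L_Gp_mult_vec(2)[OF n m v(1), of \<delta>] Av[of n] m by (simp add: X_def)
    show "v $ (n + j) - v $ n = z * v $ (n + j)" if "1 \<le> j" "j < m" for j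
      using L_Gp_mult_vec(3)[OF n m v(1) that, of \<delta>] Av[of "n + j"] that by simp
    show "(\<exists>k<n. X k \<noteq> 0) \<or> v $ n \<noteq> 0 \<or> (\<exists>j\<in>{1..<m}. v $ (n + j) \<noteq> 0)"
    proof (rule ccontr)
      assume no: "\<not> ?thesis"
      have "v $ i = 0" if i: "i < n + m" for i
      proof -
        consider "i < n" | "i = n" | "n < i" by linarith
        then show ?thesis
        proof cases
          case 1
          then show ?thesis using no by (auto simp: X_def)
        next
          case 3
          then have "i - n \<in> {1..<m}" "n + (i - n) = i" using i by auto
          then show ?thesis using no by metis
        qed (use no in auto)
      qed
      then have "v = 0\<^sub>v (n + m)" using v(1) by auto
      then show False using v(2) by blast
    qed
  qed
qed

text \<open>Eigenvectors constant on the leaves provide all the witnesses constructed below.\<close>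

lemma L_Gp_eigenvalueI:
  fixes \<delta> :: real and z b y :: complex and x :: "nat \<Rightarrow> complex"
  assumes n: "n \<ge> 3" and m: "m > 0"
    and cyc: "\<And>i. i < n \<Longrightarrow> 2 * x i - x ((i + 1) mod n) - x ((i + n - 1) mod n)
      + (if i = 0 then \<delta> * (x 0 - b) else 0) = z * x i"
    and hub: "m * b - (\<Sum>j\<in>{1..<m}. y) - x 0 = z * b"
    and leaf: "y - b = z * y"
    and nz: "x 0 \<noteq> 0 \<or> b \<noteq> 0"
  shows "eigenvalue (cmat (L_Gp n m \<delta>)) z"
proof -
  define v where "v = vec (n + m) (\<lambda>i. if i < n then x i else if i = n then b else y)"
  have v: "v \<in> carrier_vec (n + m)" by (simp add: v_def)
  have vx: "v $ i = x i" if "i < n" for i using that by (simp add: v_def)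
  have vn: "v $ n = b" using m by (simp add: v_def)
  have vy: "v $ (n + j) = y" if "1 \<le> j" "j < m" for j using that by (simp add: v_def)
  have A: "cmat (L_Gp n m \<delta>) \<in> carrier_mat (n + m) (n + m)"
    using L_Gp_carrier by (simp add: cmat_def)
  have "(cmat (L_Gp n m \<delta>) *\<^sub>v v) $ i = z * v $ i" if i: "i < n + m" for i
  proof -
    consider "i < n" | "i = n" | "n < i" by linarith
    then show ?thesis
    proof cases
      case 1
      have "(i + 1) mod n < n" "(i + n - 1) mod n < n" "0 < n" using n by auto
      then show ?thesis
        using L_Gp_mult_vec(1)[OF n m v 1, of \<delta>] cyc[OF 1] 1 by (simp only: vx vn)
    next
      case 2
      have "(\<Sum>j\<in>{1..<m}. v $ (n + j)) = (\<Sum>j\<in>{1..<m}. y)"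
        by (intro sum.cong) (auto simp: vy)
      then show ?thesis
        using L_Gp_mult_vec(2)[OF n m v, of \<delta>] hub n 2 by (simp only: vn vx[of 0])
    next
      case 3
      then have j: "1 \<le> i - n" "i - n < m" "n + (i - n) = i" using i by auto
      then show ?thesis
        using L_Gp_mult_vec(3)[OF n m v j(1,2), of \<delta>] leaf vy[OF j(1,2)] by (simp add: vn)
    qed
  qed
  then have "cmat (L_Gp n m \<delta>) *\<^sub>v v = z \<cdot>\<^sub>v v" using A v by (intro eq_vecI) auto
  moreover have "v \<noteq> 0\<^sub>v (n + m)"
  proof
    assume "v = 0\<^sub>v (n + m)"
    then have "v $ 0 = 0" "v $ n = 0" using n m by simp_all
    then show False using nz vx[of 0] vn n by simp
  qed
  ultimately show ?thesis using A v by (auto simp: eigenvalue_def eigenvector_def)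
qed

text \<open>A Rayleigh quotient in the symmetrising weights: \<open>D\<close> is the Dirichlet
  energy over the edges, \<open>W\<close> the weighted squared norm, and \<open>D = z W\<close> with
  \<open>W > 0\<close>.\<close>

lemma L_Gp_eigenvalue_nonneg:
  assumes n: "n \<ge> 3" and m: "m > 0" and \<delta>: "\<delta> > 0"
    and ev: "eigenvalue (cmat (L_Gp n m \<delta>)) z"
  shows "z \<in> \<real> \<and> 0 \<le> Re z"
proof -
  obtain X :: "nat \<Rightarrow> complex" and b :: complex and y :: "nat \<Rightarrow> complex"
    where per: "X n = X 0" "X (n + 1) = X 1"
    and cyc: "\<And>k. k < n \<Longrightarrow> 2 * X (k + 1) - X (k + 2) - X k
          = z * X (k + 1) - (if k + 1 = n then \<delta> * (X 0 - b) else 0)"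
    and hub: "m * b - (\<Sum>j\<in>{1..<m}. y j) - X 0 = z * b"
    and leaf: "\<And>j. 1 \<le> j \<Longrightarrow> j < m \<Longrightarrow> y j - b = z * y j"
    and nz: "(\<exists>k<n. X k \<noteq> 0) \<or> b \<noteq> 0 \<or> (\<exists>j\<in>{1..<m}. y j \<noteq> 0)"
    by (rule L_Gp_eigenvalueE[OF n m ev]) blast
  define D where "D = (\<Sum>k<n. (cmod (X (k + 1) - X k))\<^sup>2)
    + \<delta> * ((cmod (X 0 - b))\<^sup>2 + (\<Sum>j\<in>{1..<m}. (cmod (y j - b))\<^sup>2))"
  define W where "W = (\<Sum>k<n. (cmod (X k))\<^sup>2)
    + \<delta> * ((cmod b)\<^sup>2 + (\<Sum>j\<in>{1..<m}. (cmod (y j))\<^sup>2))"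
  have shift: "(\<Sum>k<n. f (k + 1)) = (\<Sum>k<n. f k)" if "f n = f 0" for f :: "nat \<Rightarrow> complex"
    using sum.lessThan_Suc_shift[of f n] sum.lessThan_Suc[of f n] that by simp
  \<comment> \<open>Summation by parts: each squared difference splits into two halves, and shifting
    the second by one node centres both at \<open>k + 1\<close>, where the cycle equation
    applies.\<close>
  have "(\<Sum>k<n. (X (k + 1) - X k) * cnj (X (k + 1) - X k))
    = (\<Sum>k<n. (X (k + 1) * cnj (X (k + 1)) - cnj (X (k + 1)) * X k)
        + (X k * cnj (X k) - cnj (X k) * X (k + 1)))"
    by (intro sum.cong) (simp_all add: algebra_simps)
  also have "\<dots> = (\<Sum>k<n. X (k + 1) * cnj (X (k + 1)) - cnj (X (k + 1)) * X k)
        + (\<Sum>k<n. X k * cnj (X k) - cnj (X k) * X (k + 1))"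
    by (simp add: sum.distrib)
  also have "(\<Sum>k<n. X k * cnj (X k) - cnj (X k) * X (k + 1))
      = (\<Sum>k<n. X (k + 1) * cnj (X (k + 1)) - cnj (X (k + 1)) * X (k + 1 + 1))"
    using per by (intro shift[symmetric]) simp
  also have "(\<Sum>k<n. X (k + 1) * cnj (X (k + 1)) - cnj (X (k + 1)) * X k)
      + (\<Sum>k<n. X (k + 1) * cnj (X (k + 1)) - cnj (X (k + 1)) * X (k + 1 + 1))
      = (\<Sum>k<n. cnj (X (k + 1)) * (2 * X (k + 1) - X (k + 2) - X k))"
    unfolding sum.distrib[symmetric] by (intro sum.cong) (simp_all add: algebra_simps)
  also have "\<dots> = (\<Sum>k<n. z * (X (k + 1) * cnj (X (k + 1)))
      - (if k = n - 1 then \<delta> * (X 0 - b) * cnj (X n) else 0))"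
  proof (intro sum.cong refl)
    fix k assume "k \<in> {..<n}"
    then show "cnj (X (k + 1)) * (2 * X (k + 1) - X (k + 2) - X k) = z * (X (k + 1) * cnj (X (k + 1)))
      - (if k = n - 1 then \<delta> * (X 0 - b) * cnj (X n) else 0)"
      using n by (subst cyc) (auto simp: algebra_simps)
  qed
  also have "\<dots> = z * (\<Sum>k<n. X (k + 1) * cnj (X (k + 1))) - \<delta> * (X 0 - b) * cnj (X 0)"
    using n per by (simp add: sum_subtractf sum_distrib_left)
  also have "(\<Sum>k<n. X (k + 1) * cnj (X (k + 1))) = (\<Sum>k<n. X k * cnj (X k))"
    using per by (intro shift) simp
  finally have cycle: "(\<Sum>k<n. (X (k + 1) - X k) * cnj (X (k + 1) - X k))
    = z * (\<Sum>k<n. X k * cnj (X k)) - \<delta> * (X 0 - b) * cnj (X 0)" .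
  have "(\<Sum>j\<in>{1..<m}. (y j - b) * cnj (y j - b))
      = (\<Sum>j\<in>{1..<m}. z * (y j * cnj (y j)) - cnj b * y j + b * cnj b)"
  proof (intro sum.cong refl)
    fix j assume "j \<in> {1..<m}"
    then have "(y j - b) * cnj (y j) = z * y j * cnj (y j)"
      using leaf[of j] by simp
    then show "(y j - b) * cnj (y j - b) = z * (y j * cnj (y j)) - cnj b * y j + b * cnj b"
      by (simp add: algebra_simps)
  qed
  also have "\<dots> = z * (\<Sum>j\<in>{1..<m}. y j * cnj (y j)) - cnj b * (\<Sum>j\<in>{1..<m}. y j)
      + (of_nat m - 1) * (b * cnj b)"
    using m by (simp add: sum.distrib sum_subtractf sum_distrib_left of_nat_diff)
  finally have star: "(\<Sum>j\<in>{1..<m}. (y j - b) * cnj (y j - b))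
    = z * (\<Sum>j\<in>{1..<m}. y j * cnj (y j)) - cnj b * (\<Sum>j\<in>{1..<m}. y j)
      + (of_nat m - 1) * (b * cnj b)" .
  have ysum: "(\<Sum>j\<in>{1..<m}. y j) = m * b - X 0 - z * b"
    using hub by (simp add: algebra_simps)
  \<comment> \<open>The boundary terms of the cycle and star sums cancel against the coupling energy
    \<open>\<delta> (cmod (X 0 - b))\<^sup>2\<close>.\<close>
  have "complex_of_real D = z * complex_of_real W"
    unfolding D_def W_def of_real_add of_real_mult of_real_sum complex_norm_square cycle star ysum
    by (simp add: algebra_simps)
  moreover have "W > 0"
  proof -
    have "(\<exists>k<n. (cmod (X k))\<^sup>2 > 0) \<or> (cmod b)\<^sup>2 > 0 \<or> (\<exists>j\<in>{1..<m}. (cmod (y j))\<^sup>2 > 0)"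
      using nz by simp
    moreover have "(\<Sum>k<n. (cmod (X k))\<^sup>2) > 0" if "\<exists>k<n. (cmod (X k))\<^sup>2 > 0"
      using that by (metis finite_lessThan lessThan_iff sum_pos2 zero_le_power2)
    moreover have "(\<Sum>j\<in>{1..<m}. (cmod (y j))\<^sup>2) > 0" if "\<exists>j\<in>{1..<m}. (cmod (y j))\<^sup>2 > 0"
      using that by (metis finite_atLeastLessThan sum_pos2 zero_le_power2)
    moreover have "(\<Sum>k<n. (cmod (X k))\<^sup>2) \<ge> 0" "(\<Sum>j\<in>{1..<m}. (cmod (y j))\<^sup>2) \<ge> 0"
      by (simp_all add: sum_nonneg)
    ultimately show ?thesis unfolding W_def using \<delta>
      by (smt (verit) mult_nonneg_nonneg mult_pos_pos zero_le_power2)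
  qed
  ultimately have "z = complex_of_real (D / W)" by (simp add: field_simps)
  moreover have "D \<ge> 0" unfolding D_def using \<delta>
    by (intro add_nonneg_nonneg mult_nonneg_nonneg sum_nonneg) auto
  ultimately show ?thesis using \<open>W > 0\<close> by simp
qed

section \<open>The unmodified graph\<close>

lemma beta_minus_props:
  assumes m: "m \<ge> 2"
  defines "\<beta> \<equiv> beta_minus m"
  shows "0 < \<beta>" "\<beta> < 1" "\<beta>\<^sup>2 - (m + 1) * \<beta> + 1 = 0"
proof -
  define s where "s = sqrt ((real m + 1)\<^sup>2 - 4)"
  have m': "real m \<ge> 2" using m by simp
  then have "2\<^sup>2 \<le> (real m + 1)\<^sup>2" by (intro power_mono) auto
  then have s2: "s\<^sup>2 = (real m + 1)\<^sup>2 - 4" by (simp add: s_def)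
  have "s < real m + 1" unfolding s_def by (rule real_less_lsqrt) (use m' in auto)
  moreover have "real m - 1 < s" unfolding s_def
    by (rule real_less_rsqrt) (use m' in \<open>simp add: power2_eq_square algebra_simps\<close>)
  moreover have \<beta>: "\<beta> = (real m + 1 - s) / 2" by (simp add: \<beta>_def beta_minus_def s_def)
  ultimately show "0 < \<beta>" "\<beta> < 1" by simp_all
  have "4 * (\<beta>\<^sup>2 - (m + 1) * \<beta> + 1) = s\<^sup>2 - (real m + 1)\<^sup>2 + 4"
    unfolding \<beta> by (simp add: field_simps power2_eq_square)
  then show "\<beta>\<^sup>2 - (m + 1) * \<beta> + 1 = 0" using s2 by simp
qed

text \<open>\<open>L_G\<close> is block triangular: either the cycle part is nonzero and
  \<open>z\<close> is a cycle eigenvalue, or it vanishes and \<open>z\<close> belongs to the star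
  block.\<close>

lemma L_G_eigenvalue:
  assumes n: "n \<ge> 3" and m: "m \<ge> 2" and ev: "eigenvalue (cmat (L_G n m)) z" and z: "z \<noteq> 0"
  shows "Re z \<ge> min (alpha n 2) (beta_minus m)"
proof -
  have m0: "m > 0" using m by simp
  obtain X :: "nat \<Rightarrow> complex" and b :: complex and y :: "nat \<Rightarrow> complex"
    where per: "X n = X 0" "X (n + 1) = X 1"
    and cyc: "\<And>k. k < n \<Longrightarrow> 2 * X (k + 1) - X (k + 2) - X k
          = z * X (k + 1) - (if k + 1 = n then 0 * (X 0 - b) else 0)"
    and hub: "m * b - (\<Sum>j\<in>{1..<m}. y j) - X 0 = z * b"
    and leaf: "\<And>j. 1 \<le> j \<Longrightarrow> j < m \<Longrightarrow> y j - b = z * y j"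
    and nz: "(\<exists>k<n. X k \<noteq> 0) \<or> b \<noteq> 0 \<or> (\<exists>j\<in>{1..<m}. y j \<noteq> 0)"
    by (rule L_Gp_eigenvalueE[OF n m0 ev[folded L_Gp_0], unfolded of_real_0]) blast
  define \<beta> where "\<beta> = beta_minus m"
  note \<beta> = beta_minus_props[OF m, folded \<beta>_def]
  show ?thesis
  proof (cases "\<exists>k<n. X k \<noteq> 0")
    case True
    then obtain k where "k < n" "X k \<noteq> 0" by blast
    then have k: "k \<le> n" "X k \<noteq> 0" by simp_all
    obtain j where j: "j < n" "z = alpha n (2 * j)"
      using cycle_spectrum[OF _ per _ k, of z] cyc n by auto
    then have "j \<ge> 1" using z by (cases j) (auto simp: alpha_def)
    then show ?thesis using alpha_even_ge[OF _ j(1)] j(2) by simp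
  next
    case False
    then have X0: "X 0 = 0" using n by auto
    show ?thesis
    proof (cases "z = 1")
      \<comment> \<open>This value arises from leaf vectors with zero sum; it is harmless because
        \<open>\<beta> < 1\<close>.\<close>
      case True
      then show ?thesis using \<beta>(2) by (simp add: \<beta>_def)
    next
      case z1: False
      have "b \<noteq> 0"
      proof
        assume "b = 0"
        then have "y j = 0" if "1 \<le> j" "j < m" for j
          using leaf[OF that] z1 by (metis diff_zero mult_cancel_right1)
        then show False using nz False \<open>b = 0\<close> by auto
      qed
      then have "z\<^sup>2 - (m + 1) * z + 1 = 0"
        using star_equation[OF m0 hub leaf] X0 by (simp add: add.commute)
      moreover have "complex_of_real (\<beta>\<^sup>2 - (m + 1) * \<beta> + 1) = 0" using \<beta>(3) by simp
      then have "complex_of_real \<beta> * \<beta> - (m + 1) * \<beta> + 1 = 0" by (simp add: power2_eq_square)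
      \<comment> \<open>By Vieta the second root is \<open>m + 1 - \<beta>\<close>, which exceeds
        \<open>\<beta>\<close> because \<open>\<beta> < 1\<close>.\<close>
      moreover have "(z - \<beta>) * (z - (m + 1 - \<beta>))
          = (z\<^sup>2 - (m + 1) * z + 1) - (complex_of_real \<beta> * \<beta> - (m + 1) * \<beta> + 1)"
        by (simp add: power2_eq_square algebra_simps)
      ultimately have "(z - \<beta>) * (z - (m + 1 - \<beta>)) = 0"
        by (simp only: diff_self)
      then have "z = \<beta> \<or> z = complex_of_real (m + 1 - \<beta>)" by auto
      then have "Re z = \<beta> \<or> Re z = m + 1 - \<beta>" by auto
      then have "Re z \<ge> \<beta>" using \<beta>(2) m by auto
      then show ?thesis by (simp add: \<beta>_def)
    qed
  qed
qed

text \<open>The eigenvector is 0 on the cycle, \<open>1 - \<beta>\<close> at the hub and 1 on the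
  leaves; the hub equation is then the quadratic for \<open>\<beta>\<close>.\<close>

lemma L_G_eigenvalue_beta_minus:
  assumes n: "n \<ge> 3" and m: "m \<ge> 2"
  shows "eigenvalue (cmat (L_G n m)) (beta_minus m)"
proof -
  define \<beta> where "\<beta> = beta_minus m"
  note \<beta> = beta_minus_props[OF m, folded \<beta>_def]
  have "real m * (1 - \<beta>) - (\<Sum>j\<in>{1..<m}. 1) = \<beta> * (1 - \<beta>)"
    using \<beta>(3) m by (simp add: of_nat_diff power2_eq_square algebra_simps)
  then have "complex_of_real (real m * (1 - \<beta>) - (\<Sum>j\<in>{1..<m}. 1)) = complex_of_real (\<beta> * (1 - \<beta>))"
    by (rule arg_cong)
  then have "eigenvalue (cmat (L_Gp n m 0)) \<beta>"
    using n m \<beta>(2) by (intro L_Gp_eigenvalueI[where x = "\<lambda>_. 0" and b = "1 - complex_of_real \<beta>" and y = 1]) auto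
  then show ?thesis by (simp add: L_Gp_0 \<beta>_def)
qed

lemma L_Gp_row_sums:
  assumes n: "n \<ge> 3" and m: "m > 0" and i: "i < n + m"
  shows "(\<Sum>k<n + m. L_Gp n m \<delta> $$ (i, k)) = 0"
proof -
  have [simp]: "dim_row (adj_Gp n m \<delta>) = n + m"
    by (simp add: adj_Gp_def cycle_adj_def star_adj_def)
  have "(\<Sum>k<n + m. L_Gp n m \<delta> $$ (i, k))
    = (\<Sum>k<n + m. (if i = k then \<Sum>l<n + m. adj_Gp n m \<delta> $$ (i, l) else 0) - adj_Gp n m \<delta> $$ (i, k))"
    unfolding laplacian_adj_Gp[OF n m] using i by (intro sum.cong) (auto simp: laplacian_def)
  then show ?thesis using i by (simp add: sum_subtractf)
qed

lemma L_Gp_eigenvalue_0: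
  assumes "n \<ge> 3" and "m > 0"
  shows "eigenvalue (cmat (L_Gp n m \<delta>)) 0"
  using assms by (intro L_Gp_eigenvalueI[where x = "\<lambda>_. 1" and b = 1 and y = 1])
    (auto simp: of_nat_diff)

text \<open>Nonnegativity is left as a hypothesis because its source differs: the Rayleigh quotient
  for \<open>\<delta> > 0\<close>, the block structure for \<open>\<delta> = 0\<close>.\<close>

lemma lambda2_L_Gp:
  assumes n: "n \<ge> 3" and m: "m > 0" and \<delta>: "\<delta> \<ge> 0"
    and nonneg: "\<And>z. eigenvalue (cmat (L_Gp n m \<delta>)) z \<Longrightarrow> 0 \<le> Re z"
  shows "\<exists>z. z \<noteq> 0 \<and> eigenvalue (cmat (L_Gp n m \<delta>)) z \<and> lambda2 (L_Gp n m \<delta>) = Re z"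
proof (rule lambda2_zero_row_sums[OF L_Gp_carrier])
  show "\<forall>i<n + m. v $ i = v $ 0" if "v \<in> carrier_vec (n + m)"
    "\<And>i. i < n + m \<Longrightarrow> (cmat (L_Gp n m \<delta>) *\<^sub>v v) $ i = c" for v c
    using L_Gp_mult_vec_const[OF n m \<delta> that] .
qed (use n m L_Gp_row_sums nonneg in auto)

subsection \<open>The secular equation\<close>

lemma alpha_props:
  assumes n: "n \<ge> 3"
  shows "0 < alpha n 1" "alpha n 1 < alpha n 2"
proof -
  have "pi / n < 2 * pi / n" "2 * pi / n \<le> pi" "0 < pi / n"
    using n by (simp_all add: field_simps)
  then have "cos (2 * pi / n) < cos (pi / n)" "cos (pi / n) < cos 0"
    by (intro cos_monotone_0_pi; simp)+
  then show "0 < alpha n 1" "alpha n 1 < alpha n 2"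
    by (simp_all add: alpha_def)
qed

lemma angle_exists:
  assumes n: "n \<ge> 3" and l: "0 < l" "l \<le> alpha n 2"
  obtains \<theta> where "l = 2 - 2 * cos \<theta>" "0 < \<theta>" "\<theta> \<le> 2 * pi / n" "\<theta> < pi"
proof -
  have n2: "0 \<le> 2 * pi / n" "2 * pi / n < pi" using n by (simp_all add: field_simps)
  have a2: "alpha n 2 = 2 - 2 * cos (2 * pi / n)" by (simp add: alpha_def)
  obtain \<theta> where \<theta>: "0 \<le> \<theta>" "\<theta> \<le> 2 * pi / n" "cos \<theta> = 1 - l / 2"
    using IVT2'[of cos "2 * pi / n" "1 - l / 2" 0] l n2 a2 continuous_on_cos_real by auto
  have "\<theta> \<noteq> 0" using \<theta>(3) l(1) by auto
  then show thesis using that[of \<theta>] \<theta> n2 by auto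
qed

text \<open>With \<open>\<lambda> = 2 - 2 cos \<theta>\<close> and cycle components \<open>cos ((n/2 - k) \<theta>)\<close> of an eigenvector, the
  equations at node 0 of the cycle and at the hub are solvable iff this function vanishes.\<close>

definition secular :: "nat \<Rightarrow> nat \<Rightarrow> real \<Rightarrow> real \<Rightarrow> real" where
  "secular n m \<delta> \<theta> = (let l = 2 - 2 * cos \<theta> in
     \<delta> * l * (l - m) * cos (n * \<theta> / 2)
     - 2 * (l\<^sup>2 - (m + 1) * l + 1) * (sin \<theta> * sin (n * \<theta> / 2)))"

text \<open>The node 0 equation determines \<open>b\<close>, the leaf equation determines
  \<open>y\<close>, and the secular equation is what remains at the hub. \<open>c0\<close> makes the
  vector nonzero at node 0.\<close>

lemma eigenvalue_of_secular:
  assumes n: "n \<ge> 3" and m: "m > 0" and \<delta>: "\<delta> > 0"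
    and l: "l = 2 - 2 * cos \<theta>" "l < 1"
    and c0: "cos (n * \<theta> / 2) \<noteq> 0" and sec: "secular n m \<delta> \<theta> = 0"
  shows "eigenvalue (cmat (L_Gp n m \<delta>)) (complex_of_real l)"
proof -
  \<comment> \<open>Symmetric about \<open>n / 2\<close>, so the recurrence closes up around the
    cycle and can fail only at node 0.\<close>
  define c where "c k = cos ((n / 2 - real k) * \<theta>)" for k
  define s where "s = sin \<theta> * sin (n * \<theta> / 2)"
  \<comment> \<open>Both neighbours of node 0 carry \<open>c 0 * cos \<theta> + s\<close>, so its
    equation reduces to \<open>\<delta> (c 0 - b) = 2 s\<close>.\<close>
  define b where "b = c 0 - 2 * s / \<delta>"
  define y where "y = b / (1 - l)"
  have rec: "2 * c k - cos ((n / 2 - (real k + 1)) * \<theta>) - cos ((n / 2 - (real k - 1)) * \<theta>) = l * c k" for k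
  proof -
    have "2 * cos t - cos (t - \<theta>) - cos (t + \<theta>) = l * cos t" for t
      by (simp add: l cos_add cos_diff algebra_simps)
    moreover have "(n / 2 - (real k + 1)) * \<theta> = (n / 2 - real k) * \<theta> - \<theta>"
      "(n / 2 - (real k - 1)) * \<theta> = (n / 2 - real k) * \<theta> + \<theta>" by (simp_all add: algebra_simps)
    ultimately show ?thesis by (simp only: c_def)
  qed
  have cn: "c n = c 0"
  proof -
    have "(n / 2 - real n) * \<theta> = - ((n / 2 - real 0) * \<theta>)" by (simp add: algebra_simps)
    then show ?thesis unfolding c_def by (simp only: cos_minus)
  qed
  have cn1: "c (n - 1) = c 1"
  proof -
    have "(n / 2 - real (n - 1)) * \<theta> = - ((n / 2 - real 1) * \<theta>)"
      using n by (simp add: of_nat_diff algebra_simps)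
    then show ?thesis unfolding c_def by (simp only: cos_minus)
  qed
  have succ: "c ((i + 1) mod n) = cos ((n / 2 - (real i + 1)) * \<theta>)" if "i < n" for i
  proof (cases "i + 1 = n")
    case True
    then have i: "real i + 1 = real n" by linarith
    have "c ((i + 1) mod n) = c n" using True cn by simp
    then show ?thesis unfolding i by (simp only: c_def)
  qed (use that in \<open>simp add: c_def add.commute\<close>)
  have pred: "c ((i + n - 1) mod n) = cos ((n / 2 - (real i - 1)) * \<theta>)" if "0 < i" "i < n" for i
  proof -
    have "(i + n - 1) mod n = i - 1" using that by (auto simp: mod_if)
    then show ?thesis using that by (simp add: c_def of_nat_diff)
  qed
  have cyc: "2 * c i - c ((i + 1) mod n) - c ((i + n - 1) mod n)
      + (if i = 0 then \<delta> * (c 0 - b) else 0) = l * c i" if i: "i < n" for i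
  proof (cases "i = 0")
    case False
    then show ?thesis using rec[of i] i by (simp only: succ pred) simp
  next
    case True
    have "c ((0 + n - 1) mod n) = c 1" using n cn1 by simp
    moreover have "c 1 = cos (n * \<theta> / 2) * cos \<theta> + s"
      by (simp add: c_def s_def cos_diff left_diff_distrib)
    moreover have "c ((0 + 1) mod n) = c 1" using n by simp
    moreover have "c 0 = cos (n * \<theta> / 2)" by (simp add: c_def)
    ultimately show ?thesis using True \<delta> by (simp add: b_def l algebra_simps)
  qed
  have c0': "c 0 = cos (n * \<theta> / 2)" by (simp add: c_def)
  define q where "q = l\<^sup>2 - (m + 1) * l + 1"
  have "\<delta> * l * (l - m) * c 0 = 2 * q * s"
    using sec by (simp add: secular_def Let_def l s_def q_def c0' add.commute)
  \<comment> \<open>Since \<open>l (l - m) = q - (1 - l)\<close>, the secular equation becomes the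
    star equation \<open>q b = (1 - l) c 0\<close>.\<close>
  then have "\<delta> * (q * b) = \<delta> * ((1 - l) * c 0)"
    using \<delta> by (simp add: b_def q_def field_simps power2_eq_square)
  then have q: "q * b = (1 - l) * c 0" using \<delta> by simp
  have leaf: "y - b = l * y" using l(2) by (simp add: y_def field_simps)
  have "(1 - l) * (m * b - (real m - 1) * y - c 0) = (1 - l) * (l * b)"
  proof -
    have y: "(1 - l) * y = b" using l(2) by (simp add: y_def)
    have "(1 - l) * (m * b - (real m - 1) * y - c 0) = (1 - l) * m * b - (real m - 1) * ((1 - l) * y) - (1 - l) * c 0"
      by (simp add: algebra_simps)
    then show ?thesis unfolding y q[symmetric] by (simp add: q_def algebra_simps power2_eq_square)
  qed
  then have hub: "m * b - (\<Sum>j\<in>{1..<m}. y) - c 0 = l * b"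
    using l(2) m by (simp add: of_nat_diff)
  show ?thesis
  proof (rule L_Gp_eigenvalueI[OF n m, of "\<lambda>k. complex_of_real (c k)" _ "complex_of_real b" _ "complex_of_real y"])
    show "2 * complex_of_real (c i) - complex_of_real (c ((i + 1) mod n))
        - complex_of_real (c ((i + n - 1) mod n))
        + (if i = 0 then complex_of_real \<delta> * (complex_of_real (c 0) - complex_of_real b) else 0)
        = complex_of_real l * complex_of_real (c i)" if "i < n" for i
      using arg_cong[OF cyc[OF that], of complex_of_real] by (cases "i = 0") simp_all
    show "of_nat m * complex_of_real b - (\<Sum>j\<in>{1..<m}. complex_of_real y) - complex_of_real (c 0)
        = complex_of_real l * complex_of_real b"
      using arg_cong[OF hub, of complex_of_real] by simp
    show "complex_of_real y - complex_of_real b = complex_of_real l * complex_of_real y"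
      using arg_cong[OF leaf, of complex_of_real] by simp
    show "complex_of_real (c 0) \<noteq> 0 \<or> complex_of_real b \<noteq> 0" using c0 c0' by simp
  qed
qed

text \<open>The intermediate value theorem for \<open>secular\<close> between \<open>pi / n\<close>,
  where only the negative second term is left, and \<open>\<theta>1\<close>, where only the positive
  first term is left.\<close>

lemma L_Gp_small_eigenvalue:
  assumes n: "n \<ge> 3" and m: "m \<ge> 4" and \<delta>: "\<delta> > 0" and a1: "alpha n 1 < beta_minus m"
  shows "\<exists>l. 0 < l \<and> l < min (alpha n 2) (beta_minus m) \<and> eigenvalue (cmat (L_Gp n m \<delta>)) (complex_of_real l)"
proof -
  define \<beta> where "\<beta> = beta_minus m"
  have m2: "m \<ge> 2" using m by simp
  note \<beta> = beta_minus_props[OF m2, folded \<beta>_def]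
  note alpha = alpha_props[OF n]
  \<comment> \<open>The smallest nonzero eigenvalue of \<open>L_G\<close>, to be undercut.\<close>
  define \<mu> where "\<mu> = min (alpha n 2) \<beta>"
  have \<mu>: "alpha n 1 < \<mu>" "\<mu> < 1" "0 < \<mu>" "\<mu> \<le> alpha n 2"
    using alpha \<beta> a1 by (auto simp: \<mu>_def \<beta>_def)
  obtain \<theta>1 where \<theta>1: "\<mu> = 2 - 2 * cos \<theta>1" "0 < \<theta>1" "\<theta>1 \<le> 2 * pi / n" "\<theta>1 < pi"
    using angle_exists[OF n \<mu>(3,4)] .
  have n0: "real n > 0" using n by simp
  have pin: "0 < pi / n" "pi / n < pi" using n by (simp_all add: field_simps)
  have al1: "alpha n 1 = 2 - 2 * cos (pi / n)" by (simp add: alpha_def)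
  have lt: "pi / n < \<theta>1"
  proof (rule ccontr)
    assume "\<not> ?thesis"
    then have "cos (pi / n) \<le> cos \<theta>1" using \<theta>1 pin by (intro cos_monotone_0_pi_le) auto
    then show False using \<mu>(1) \<theta>1(1) al1 by simp
  qed
  have half: "pi / 2 < n * \<theta> / 2" "n * \<theta> / 2 \<le> pi" if "pi / n < \<theta>" "\<theta> \<le> \<theta>1" for \<theta> :: real
  proof -
    show "pi / 2 < n * \<theta> / 2" using that(1) n0 by (simp add: field_simps)
    have "\<theta> \<le> 2 * pi / n" using that \<theta>1 by simp
    then show "n * \<theta> / 2 \<le> pi" using n0 by (simp add: field_simps)
  qed
  have cosneg: "cos (n * \<theta> / 2) < 0" if "pi / n < \<theta>" "\<theta> \<le> \<theta>1" for \<theta> :: real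
  proof -
    have "cos (n * \<theta> / 2) < cos (pi / 2)"
      using half[OF that] by (intro cos_monotone_0_pi) auto
    then show ?thesis by simp
  qed
  define q where "q l = l\<^sup>2 - (m + 1) * l + 1" for l :: real
  have qpos: "q l > 0" if "l < \<beta>" for l
  proof -
    have "q l = (\<beta> - l) * (m + 1 - \<beta> - l)"
      using \<beta>(3) unfolding q_def by (simp add: algebra_simps power2_eq_square)
    moreover have "m + 1 - \<beta> - l > 0" using that \<beta>(2) m by simp
    ultimately show ?thesis using that by simp
  qed
  have F1: "secular n m \<delta> (pi / n) < 0"
  proof -
    have "sin (pi / n) > 0" using pin by (intro sin_gt_zero) auto
    moreover have "n * (pi / n) / 2 = pi / 2" using n0 by simp
    moreover have "q (2 - 2 * cos (pi / n)) > 0"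
      using qpos[of "alpha n 1"] a1 al1 by (simp add: \<beta>_def)
    ultimately show ?thesis unfolding secular_def Let_def by (simp add: q_def add.commute)
  qed
  \<comment> \<open>Either \<open>\<mu> = \<beta>\<close> is a root of \<open>q\<close>, or
    \<open>\<mu> = alpha n 2\<close>, in which case \<open>\<theta>1 = 2 * pi / n\<close> and the
    sine is taken at \<open>pi\<close>.\<close>
  have "q \<mu> * sin (n * \<theta>1 / 2) = 0"
  proof (cases "\<mu> = \<beta>")
    case True
    then show ?thesis using \<beta>(3) by (simp add: q_def)
  next
    case False
    then have "alpha n 2 = \<mu>" by (auto simp: \<mu>_def)
    then have "cos (2 * pi / n) = cos \<theta>1" using \<theta>1(1) by (simp add: alpha_def)
    moreover have "2 * pi / n \<le> pi" using n by (simp add: field_simps)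
    ultimately have "\<theta>1 = 2 * pi / n"
      using \<theta>1 cos_monotone_0_pi[of \<theta>1 "2 * pi / n"] by fastforce
    then show ?thesis using n0 by simp
  qed
  then have "secular n m \<delta> \<theta>1 = \<delta> * \<mu> * (\<mu> - m) * cos (n * \<theta>1 / 2)"
    unfolding secular_def Let_def \<theta>1(1)[symmetric] by (auto simp: q_def add.commute)
  also have "\<dots> > 0"
  proof -
    have "\<delta> * \<mu> * (\<mu> - m) < 0" using \<delta> \<mu> m by (intro mult_pos_neg) auto
    then show ?thesis using cosneg[OF lt] by (intro mult_neg_neg) auto
  qed
  finally have F2: "secular n m \<delta> \<theta>1 > 0" .
  have "continuous_on {pi / n..\<theta>1} (secular n m \<delta>)"
    unfolding secular_def Let_def by (intro continuous_intros) auto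
  then obtain \<theta> where \<theta>: "pi / n \<le> \<theta>" "\<theta> \<le> \<theta>1" "secular n m \<delta> \<theta> = 0"
    using IVT'[of "secular n m \<delta>" "pi / n" 0 \<theta>1] F1 F2 lt by auto
  \<comment> \<open>The endpoint values are nonzero, so the zero is interior; this gives both
    \<open>l < \<mu>\<close> and a nonvanishing cosine.\<close>
  have \<theta>': "pi / n < \<theta>" "\<theta> < \<theta>1" using \<theta> F1 F2 by (auto simp: order_less_le)
  define l where "l = 2 - 2 * cos \<theta>"
  have "l < \<mu>" using \<theta>' \<theta>1 pin cos_monotone_0_pi[of \<theta> \<theta>1] by (simp add: l_def)
  moreover have "l > 0" using \<theta>' \<theta>1 pin cos_monotone_0_pi[of 0 \<theta>] by (simp add: l_def)
  moreover have "eigenvalue (cmat (L_Gp n m \<delta>)) (complex_of_real l)"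
    using m \<delta> l_def \<theta>(3) cosneg[OF \<theta>'(1) \<theta>(2)] \<open>l < \<mu>\<close> \<mu>(2)
    by (intro eigenvalue_of_secular[OF n]) auto
  ultimately show ?thesis by (auto simp: \<mu>_def \<beta>_def)
qed

text \<open>Pairing the cycle equations with \<open>cos ((n/2 - k) \<theta>)\<close> eliminates all cycle
  components except the one at node 0.\<close>

lemma L_Gp_eigenvalue_gt:
  assumes n: "n \<ge> 3" and m: "m \<ge> 4" and \<delta>: "\<delta> > 0" and a1: "beta_minus m < alpha n 1"
    and ev: "eigenvalue (cmat (L_Gp n m \<delta>)) z" and z0: "z \<noteq> 0"
  shows "beta_minus m < Re z"
proof (rule ccontr)
  assume le: "\<not> ?thesis"
  have m0: "m > 0" using m by simp
  define \<beta> where "\<beta> = beta_minus m"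
  have m2: "m \<ge> 2" using m by simp
  note \<beta> = beta_minus_props[OF m2, folded \<beta>_def]
  note alpha = alpha_props[OF n]
  define l where "l = Re z"
  have zl: "z = complex_of_real l" and "l \<ge> 0"
    using L_Gp_eigenvalue_nonneg[OF n m0 \<delta> ev] by (auto simp: l_def)
  then have l: "0 < l" "l \<le> \<beta>" using z0 le by (auto simp: l_def \<beta>_def order_less_le)
  have "l < alpha n 1" "l \<le> alpha n 2" using l a1 alpha by (auto simp: \<beta>_def)
  obtain \<theta> where \<theta>: "l = 2 - 2 * cos \<theta>" "0 < \<theta>" "\<theta> < pi"
    using angle_exists[OF n l(1) \<open>l \<le> alpha n 2\<close>] by metis
  have n0: "real n > 0" using n by simp
  have "\<theta> < pi / n"
  proof (rule ccontr)
    assume "\<not> ?thesis"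
    then have "cos \<theta> \<le> cos (pi / n)" using \<theta> by (intro cos_monotone_0_pi_le) auto
    then show False using \<open>l < alpha n 1\<close> \<theta>(1) by (simp add: alpha_def)
  qed
  then have half: "0 < n * \<theta> / 2" "n * \<theta> / 2 < pi / 2"
    using \<theta>(2) n0 by (simp_all add: field_simps)
  define c where "c k = cos ((n / 2 - real k) * \<theta>)" for k
  define s where "s = sin \<theta> * sin (n * \<theta> / 2)"
  have s: "s > 0" unfolding s_def using half \<theta> by (intro mult_pos_pos sin_gt_zero) auto
  have c0: "c 0 > 0" unfolding c_def using half by (intro cos_gt_zero_pi) auto
  define q where "q = l\<^sup>2 - (m + 1) * l + 1"
  have q: "q \<ge> 0"
  proof -
    have "q = (\<beta> - l) * (m + 1 - \<beta> - l)"
      using \<beta>(3) unfolding q_def by (simp add: algebra_simps power2_eq_square)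
    moreover have "m + 1 - \<beta> - l \<ge> 0" using l \<beta>(2) m by simp
    ultimately show ?thesis using l by simp
  qed
  \<comment> \<open>The value of \<open>secular\<close> at \<open>\<theta>\<close>: its first term
    is negative as \<open>0 < l < 1 < m\<close> and \<open>c 0 > 0\<close>, and
    \<open>q s \<ge> 0\<close>.\<close>
  have F: "\<delta> * l * (l - m) * c 0 - 2 * q * s < 0"
  proof -
    have "\<delta> * l * (l - m) * c 0 < 0"
      using \<delta> l \<beta>(2) m c0 by (intro mult_neg_pos mult_pos_neg) auto
    moreover have "2 * q * s \<ge> 0" using q s by simp
    ultimately show ?thesis by simp
  qed
  obtain X :: "nat \<Rightarrow> complex" and b :: complex and y :: "nat \<Rightarrow> complex"
    where per: "X n = X 0" "X (n + 1) = X 1"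
    and cyc: "\<And>k. k < n \<Longrightarrow> 2 * X (k + 1) - X (k + 2) - X k
          = z * X (k + 1) - (if k + 1 = n then \<delta> * (X 0 - b) else 0)"
    and hub: "m * b - (\<Sum>j\<in>{1..<m}. y j) - X 0 = z * b"
    and leaf: "\<And>j. 1 \<le> j \<Longrightarrow> j < m \<Longrightarrow> y j - b = z * y j"
    and nz: "(\<exists>k<n. X k \<noteq> 0) \<or> b \<noteq> 0 \<or> (\<exists>j\<in>{1..<m}. y j \<noteq> 0)"
    by (rule L_Gp_eigenvalueE[OF n m0 ev]) blast
  have crec: "c k + c (k + 2) = (2 - l) * c (k + 1)" for k
  proof -
    have "(n / 2 - real k) * \<theta> = (n / 2 - real (k + 1)) * \<theta> + \<theta>"
      "(n / 2 - real (k + 2)) * \<theta> = (n / 2 - real (k + 1)) * \<theta> - \<theta>" by (simp_all add: algebra_simps)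
    then show ?thesis unfolding c_def \<theta>(1) by (simp only: cos_add cos_diff) (simp add: algebra_simps)
  qed
  \<comment> \<open>The discrete Wronskian of \<open>c\<close> and \<open>X\<close>. Both obey the
    same recurrence except for the coupling at node 0, so its increments vanish for
    \<open>k < n - 1\<close>.\<close>
  define U where "U k = c (k + 1) * X k - c k * X (k + 1)" for k
  have "(\<Sum>k<n. if k = n - 1 then - (\<delta> * (X 0 - b) * c n) else 0)
    = (\<Sum>k<n. c (k + 1) * ((2 - z) * X (k + 1) - X (k + 2) - X k))"
  proof (intro sum.cong refl)
    fix k assume "k \<in> {..<n}"
    then have k: "k < n" by simp
    have "(2 - z) * X (k + 1) - X (k + 2) - X k = - (if k + 1 = n then \<delta> * (X 0 - b) else 0)"
      using cyc[OF k] by (simp add: algebra_simps)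
    then show "(if k = n - 1 then - (\<delta> * (X 0 - b) * c n) else 0)
      = c (k + 1) * ((2 - z) * X (k + 1) - X (k + 2) - X k)"
      using n k by auto
  qed
  also have "\<dots> = (\<Sum>k<n. U (Suc k) - U k)"
  proof (intro sum.cong refl)
    fix k
    have "complex_of_real (c k + c (k + 2)) = complex_of_real ((2 - l) * c (k + 1))"
      using crec by (rule arg_cong)
    then have "(2 - z) * c (k + 1) = c k + c (k + 2)" by (simp add: zl)
    moreover have "c (k + 1) * ((2 - z) * X (k + 1) - X (k + 2) - X k)
      = ((2 - z) * c (k + 1)) * X (k + 1) - c (k + 1) * X (k + 2) - c (k + 1) * X k"
      by (simp add: algebra_simps)
    ultimately have "c (k + 1) * ((2 - z) * X (k + 1) - X (k + 2) - X k)
      = (c k + c (k + 2)) * X (k + 1) - c (k + 1) * X (k + 2) - c (k + 1) * X k"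
      by (simp only:)
    then show "c (k + 1) * ((2 - z) * X (k + 1) - X (k + 2) - X k) = U (Suc k) - U k"
      by (simp add: U_def algebra_simps)
  qed
  also have "\<dots> = U n - U 0" by (rule sum_lessThan_telescope)
  also have "\<dots> = complex_of_real (c (n + 1) - c 1) * X 0"
  proof -
    have "(n / 2 - real n) * \<theta> = - ((n / 2 - real 0) * \<theta>)" by (simp add: algebra_simps)
    then have "c n = c 0" unfolding c_def by (simp only: cos_minus)
    then show ?thesis using per by (simp add: U_def algebra_simps)
  qed
  also have "c (n + 1) - c 1 = - 2 * s"
  proof -
    have "(n / 2 - real (n + 1)) * \<theta> = - (n * \<theta> / 2 + \<theta>)"
      "(n / 2 - real 1) * \<theta> = n * \<theta> / 2 - \<theta>" by (simp_all add: algebra_simps)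
    then show ?thesis unfolding c_def s_def by (simp only: cos_minus cos_add cos_diff) simp
  qed
  finally have pair: "\<delta> * c 0 * (X 0 - b) = 2 * s * X 0"
  proof -
    assume "(\<Sum>k<n. if k = n - 1 then - (\<delta> * (X 0 - b) * c n) else 0) = complex_of_real (- 2 * s) * X 0"
    moreover have "(n / 2 - real n) * \<theta> = - ((n / 2 - real 0) * \<theta>)" by (simp add: algebra_simps)
    then have "c n = c 0" unfolding c_def by (simp only: cos_minus)
    ultimately show ?thesis using n by (simp add: algebra_simps)
  qed
  have star: "q * b = (1 - l) * X 0"
    using star_equation[OF m0 hub leaf] by (simp add: q_def zl add.commute)
  \<comment> \<open>Multiplying \<open>pair\<close> by \<open>q\<close> and inserting
    \<open>star\<close> eliminates \<open>b\<close> without division and leaves the secular value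
    times \<open>X 0\<close>.\<close>
  have "complex_of_real (\<delta> * l * (l - m) * c 0 - 2 * q * s) * X 0 = 0"
  proof -
    have "complex_of_real q * (\<delta> * c 0 * (X 0 - b)) = q * (2 * s * X 0)" by (simp only: pair)
    then have "q * (\<delta> * c 0) * X 0 - (\<delta> * c 0) * (q * b) = 2 * q * s * X 0"
      by (simp add: algebra_simps)
    then have "complex_of_real (\<delta> * (q - (1 - l)) * c 0) * X 0 = complex_of_real (2 * q * s) * X 0"
      unfolding star by (simp add: algebra_simps)
    moreover have "\<delta> * (q - (1 - l)) * c 0 = \<delta> * l * (l - m) * c 0"
      by (simp add: q_def algebra_simps power2_eq_square)
    ultimately show ?thesis by (simp only: of_real_diff left_diff_distrib diff_self)
  qed
  then have X0: "X 0 = 0" using F by (metis less_irrefl mult_eq_0_iff of_real_eq_0_iff)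
  then have b0: "b = 0" using pair \<delta> c0 by simp
  have l1: "l < 1" using l \<beta> by simp
  have y0: "y j = 0" if "1 \<le> j" "j < m" for j
  proof -
    have "complex_of_real (1 - l) * y j = 0" using leaf[OF that] b0 by (simp add: zl algebra_simps)
    then show ?thesis using l1 by (metis less_irrefl mult_eq_0_iff of_real_eq_0_iff diff_gt_0_iff_gt)
  qed
  then obtain k where "k < n" "X k \<noteq> 0" using nz b0 by auto
  then have k: "k \<le> n" "X k \<noteq> 0" by simp_all
  \<comment> \<open>With \<open>X 0 = b = 0\<close> the coupling disappears and \<open>X\<close>
    solves the plain cycle equations, whose nonzero eigenvalues are at least
    \<open>alpha n 2\<close>.\<close>
  have cyc0: "2 * X (k + 1) - X (k + 2) - X k = z * X (k + 1)" if "k < n" for k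
    using cyc[OF that] X0 b0 by (simp split: if_splits)
  obtain j where j: "j < n" "z = alpha n (2 * j)"
    using cycle_spectrum[OF _ per cyc0 k] n by auto
  then have "j \<ge> 1" using z0 by (cases j) (auto simp: alpha_def)
  then have "l \<ge> alpha n 2" using alpha_even_ge[OF _ j(1)] j(2) by (simp add: zl)
  then show False using \<open>l < alpha n 1\<close> alpha by simp
qed

section \<open>Comparison of the two spectral gaps\<close>

theorem theoremA:
  fixes n m :: nat and \<delta>0 :: real
  assumes "n \<ge> 3" and "m \<ge> 4"
    and "beta_minus m \<notin> {alpha n l | l. l \<le> n}"
    and "\<delta>0 > 0"
  shows "(\<forall>z. eigenvalue (cmat (L_Gp n m \<delta>0)) z \<longrightarrow> z \<in> \<real>) \<and>
    (alpha n 1 < beta_minus m \<longrightarrow> lambda2 (L_Gp n m \<delta>0) < lambda2 (L_G n m)) \<and>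
    (beta_minus m < alpha n 1 \<longrightarrow> lambda2 (L_Gp n m \<delta>0) > lambda2 (L_G n m))"
proof (intro conjI allI impI)
  have m0: "m > 0" and m2: "m \<ge> 2" using assms(2) by simp_all
  note n = assms(1) and m = assms(2) and \<delta> = assms(4)
  note nonneg = L_Gp_eigenvalue_nonneg[OF n m0 \<delta>]
  note \<beta> = beta_minus_props[OF m2] and alpha = alpha_props[OF n]
  have L_G_carrier: "L_G n m \<in> carrier_mat (n + m) (n + m)"
    using L_Gp_carrier[of n m 0] by (simp add: L_Gp_0)
  show "z \<in> \<real>" if "eigenvalue (cmat (L_Gp n m \<delta>0)) z" for z
    using nonneg[OF that] by simp
  show "lambda2 (L_Gp n m \<delta>0) < lambda2 (L_G n m)" if a1: "alpha n 1 < beta_minus m"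
  proof -
    obtain l where l: "0 < l" "l < min (alpha n 2) (beta_minus m)"
      "eigenvalue (cmat (L_Gp n m \<delta>0)) (complex_of_real l)"
      using L_Gp_small_eigenvalue[OF n m \<delta> a1] by blast
    have "lambda2 (L_Gp n m \<delta>0) \<le> l"
      using l by (intro lambda2_le[OF L_Gp_carrier L_Gp_eigenvalue_0[OF n m0] l(3)]) auto
    also have "l < lambda2 (L_G n m)"
    proof -
      \<comment> \<open>At \<open>\<delta> = 0\<close> nonnegativity follows from the lower bound on
        nonzero eigenvalues, which is positive.\<close>
      have "0 \<le> Re z" if "eigenvalue (cmat (L_G n m)) z" for z
        using L_G_eigenvalue[OF n m2 that] alpha \<beta> by (cases "z = 0") auto
      then obtain z where "z \<noteq> 0" "eigenvalue (cmat (L_G n m)) z" "lambda2 (L_G n m) = Re z"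
        using lambda2_L_Gp[OF n m0, of 0] unfolding L_Gp_0 by auto
      then show ?thesis using L_G_eigenvalue[OF n m2] l(2) by fastforce
    qed
    finally show ?thesis .
  qed
  show "lambda2 (L_Gp n m \<delta>0) > lambda2 (L_G n m)" if a1: "beta_minus m < alpha n 1"
  proof -
    \<comment> \<open>0 and \<open>beta_minus m\<close> are two distinct eigenvalues of
      \<open>L_G\<close>, so the upper bound \<open>lambda2_le\<close> applies.\<close>
    have "lambda2 (L_G n m) \<le> beta_minus m"
      using \<beta> L_Gp_eigenvalue_0[OF n m0, of 0]
      by (intro lambda2_le[OF L_G_carrier _ L_G_eigenvalue_beta_minus[OF n m2], of 0])
        (auto simp: L_Gp_0)
    also have "beta_minus m < lambda2 (L_Gp n m \<delta>0)"
      using lambda2_L_Gp[OF n m0 less_imp_le[OF \<delta>]] nonneg L_Gp_eigenvalue_gt[OF n m \<delta> a1] by metis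
    finally show ?thesis .
  qed
qed

end
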